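(* Let $K$ be a self-affine sponge of Lalley-Gatzouras type in $\mathbb{R}^d$. Then $\dim_C K=0$ if and only if $K$ is uniformly disconnected.
   Context: **Self-affine sponge of Lalley-Gatzouras type.** A diagonal self-affine IFS on $\mathbb{R}^d$ ($d\ge 1$) is a finite family $\Phi=\{\phi_k\}_{k=1}^N$ of maps $\phi_k(x)=T_kx+b_k$ with $b_k\in\mathbb{R}^d$ and $T_k=\mathrm{diag}(T_{k,1},\dots,T_{k,d})$, $0<T_{k,i}<1$. Its attractor is the unique nonempty compact set $K\subset\mathbb{R}^d$ with $K=\bigcup_{k=1}^N\phi_k(K)$; it is always assumed that $K\subset[0,1]^d$. For $1\le i\le d$ let $\bar\pi_i(x_1,\dots,x_d)=(x_1,\dots,x_i)$ and let $\Phi_{\{1,\dots,i\}}$ be the set (each map counted once) of maps $y\mapsto \mathrm{diag}(T_{k,1},\dots,T_{k,i})y+\bar\pi_i(b_k)$ on $\mathbb{R}^i$, $1\le k\le N$. $\Phi$ satisfies the coordinate ordering condition if $T_{k,1}>T_{k,2}>\cdots>T_{k,d}$ for all $k$. $\Phi$ satisfies the neat projection condition if for each $1\le i\le d$ the IFS $\Phi_{\{1,\dots,i\}}$ satisfies the open set condition with the open unit cube $(0,1)^i$, i.e. $f((0,1)^i)\subset(0,1)^i$ for all $f\in\Phi_{\{1,\dots,i\}}$ and the sets $f((0,1)^i)$, $f\in\Phi_{\{1,\dots,i\}}$, are pairwise disjoint. $K$ (and $\Phi$) is of Lalley-Gatzouras type if both conditions hold. $K$ carries the Euclidean metric. **Uniformly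 disconnected.** For $\delta_0>0$, a $\delta_0$-sequence in a metric space $(X,\rho)$ is a sequence of distinct points $(x_0,x_1,\dots,x_n)$, $n\ge1$, with $\rho(x_i,x_{i+1})\le\delta_0\,\rho(x_0,x_n)$ for all $0\le i\le n-1$. $(X,\rho)$ is uniformly disconnected if there is $\delta_0>0$ such that no $\delta_0$-sequence exists in $X$. **Conformal dimension.** Given a homeomorphism $\eta:[0,\infty)\to[0,\infty)$, an injective map $f:(X,d_X)\to(Y,d_Y)$ between metric spaces is $\eta$-quasisymmetric if for all distinct triples $x,y,z\in X$ and all $t>0$, $\frac{d_X(x,y)}{d_X(y,z)}\le t$ implies $\frac{d_Y(f(x),f(y))}{d_Y(f(y),f(z))}\le\eta(t)$; it is quasisymmetric if this holds for some $\eta$. The conformal dimension is $\dim_C X=\inf \dim_H f(X)$, the infimum over all quasisymmetric maps $f$ defined on $X$ (into arbitrary metric spaces), where $\dim_H$ is Hausdorff dimension. *)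

theory Defs
  imports "HOL-Analysis.Analysis"
begin

section \<open>Hausdorff dimension of a metric space\<close>

definition ediam :: "('a \<Rightarrow> 'a \<Rightarrow> real) \<Rightarrow> 'a set \<Rightarrow> ennreal" where
  "ediam d U = (SUP x\<in>U. SUP y\<in>U. ennreal (d x y))"

text \<open>The size-\<open>\<delta>\<close> premeasure and the \<open>s\<close>-dimensional Hausdorff measure of the whole
  space \<open>(X, d)\<close>. Countable covers are sequences of possibly empty sets. They are only
  used with \<open>s > 0\<close>, so that \<open>0 powr s = 0\<close> is the intended value for empty sets and singletons.\<close>

definition hausdorff_premeasure ::
    "'a set \<Rightarrow> ('a \<Rightarrow> 'a \<Rightarrow> real) \<Rightarrow> real \<Rightarrow> real \<Rightarrow> ennreal" where
  "hausdorff_premeasure X d s \<delta> =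
     (INF U \<in> {U :: nat \<Rightarrow> 'a set. X = (\<Union>n. U n) \<and> (\<forall>n. ediam d (U n) \<le> ennreal \<delta>)}.
        \<Sum>n. ennreal (enn2real (ediam d (U n)) powr s))"

definition hausdorff_measure :: "'a set \<Rightarrow> ('a \<Rightarrow> 'a \<Rightarrow> real) \<Rightarrow> real \<Rightarrow> ennreal" where
  "hausdorff_measure X d s = (SUP \<delta> \<in> {0<..}. hausdorff_premeasure X d s \<delta>)"

definition hausdorff_dim :: "'a set \<Rightarrow> ('a \<Rightarrow> 'a \<Rightarrow> real) \<Rightarrow> ennreal" where
  "hausdorff_dim X d = (INF s \<in> {s. 0 < s \<and> hausdorff_measure X d s = 0}. ennreal s)"

section \<open>Quasisymmetric maps and conformal dimension\<close>

definition quasisymmetric_wrt ::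
    "(real \<Rightarrow> real) \<Rightarrow> 'a set \<Rightarrow> ('a \<Rightarrow> 'a \<Rightarrow> real) \<Rightarrow> 'b set \<Rightarrow> ('b \<Rightarrow> 'b \<Rightarrow> real) \<Rightarrow> ('a \<Rightarrow> 'b) \<Rightarrow> bool" where
  "quasisymmetric_wrt \<eta> X dX Y dY f \<longleftrightarrow>
     f ` X \<subseteq> Y \<and> inj_on f X \<and>
     (\<forall>x\<in>X. \<forall>y\<in>X. \<forall>z\<in>X. \<forall>t>0.
        x \<noteq> y \<and> y \<noteq> z \<and> x \<noteq> z \<longrightarrow> dX x y / dX y z \<le> t \<longrightarrow>
        dY (f x) (f y) / dY (f y) (f z) \<le> \<eta> t)"

definition quasisymmetric ::
    "'a set \<Rightarrow> ('a \<Rightarrow> 'a \<Rightarrow> real) \<Rightarrow> 'b set \<Rightarrow> ('b \<Rightarrow> 'b \<Rightarrow> real) \<Rightarrow> ('a \<Rightarrow> 'b) \<Rightarrow> bool" where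
  "quasisymmetric X dX Y dY f \<longleftrightarrow>
     (\<exists>\<eta> \<eta>'. homeomorphism {0..} {0..} \<eta> \<eta>' \<and> quasisymmetric_wrt \<eta> X dX Y dY f)"

text \<open>HOL cannot quantify over the type of points of the target space. Here the target is any
  metric space whose points lie in the type of \<open>X\<close>; since the maps are injective and only the
  image matters, this loses nothing: see the lemma \<open>conformal_dim_le\<close>, where the target is of
  arbitrary type.\<close>

definition conformal_dim :: "'a set \<Rightarrow> ('a \<Rightarrow> 'a \<Rightarrow> real) \<Rightarrow> ennreal" where
  "conformal_dim X dX =
     Inf {hausdorff_dim (f ` X) dY | (f :: 'a \<Rightarrow> 'a) (Y :: 'a set) dY.
            Metric_space Y dY \<and> quasisymmetric X dX Y dY f}"

lemma hausdorff_premeasure_pullback_le: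
  assumes f: "inj_on f X" and d: "\<And>x y. x \<in> X \<Longrightarrow> y \<in> X \<Longrightarrow> d x y = d' (f x) (f y)"
  shows "hausdorff_premeasure X d s \<delta> \<le> hausdorff_premeasure (f ` X) d' s \<delta>"
  unfolding hausdorff_premeasure_def
proof (rule INF_greatest)
  fix U :: "nat \<Rightarrow> 'b set"
  assume "U \<in> {U. f ` X = (\<Union>n. U n) \<and> (\<forall>n. ediam d' (U n) \<le> ennreal \<delta>)}"
  then have U: "f ` X = (\<Union>n. U n)" "\<And>n. ediam d' (U n) \<le> ennreal \<delta>" by auto
  define V where "V n = f -` U n \<inter> X" for n
  have "U n \<subseteq> f ` X" for n unfolding U(1) by (rule UN_upper) (rule UNIV_I)
  then have fV: "U n = f ` V n" for n unfolding V_def by fast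
  have VX: "V n \<subseteq> X" for n unfolding V_def by (rule Int_lower2)
  have dV: "d x y = d' (f x) (f y)" if "x \<in> V n" "y \<in> V n" for x y n
    using d VX that by blast
  have e: "ediam d (V n) = ediam d' (U n)" for n
    unfolding ediam_def fV image_image
    by (intro SUP_cong refl) (simp add: dV[of _ n])
  have "X \<subseteq> (\<Union>n. V n)"
  proof
    fix x assume x: "x \<in> X"
    then have "f x \<in> (\<Union>n. U n)" unfolding U(1)[symmetric] by (rule imageI)
    then show "x \<in> (\<Union>n. V n)" using x unfolding V_def by fast
  qed
  then have "X = (\<Union>n. V n)" using VX by (intro subset_antisym UN_least)
  then have V: "V \<in> {U. X = (\<Union>n. U n) \<and> (\<forall>n. ediam d (U n) \<le> ennreal \<delta>)}"
    using U(2) unfolding e[symmetric] by blast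
  show "(INF U \<in> {U. X = (\<Union>n. U n) \<and> (\<forall>n. ediam d (U n) \<le> ennreal \<delta>)}.
      \<Sum>n. ennreal (enn2real (ediam d (U n)) powr s))
      \<le> (\<Sum>n. ennreal (enn2real (ediam d' (U n)) powr s))"
    by (rule INF_lower2[OF V]) (simp only: e order_refl)
qed

lemma hausdorff_dim_pullback_le:
  assumes f: "inj_on f X" and d: "\<And>x y. x \<in> X \<Longrightarrow> y \<in> X \<Longrightarrow> d x y = d' (f x) (f y)"
  shows "hausdorff_dim X d \<le> hausdorff_dim (f ` X) d'"
proof -
  have pre: "hausdorff_premeasure X d s \<delta> \<le> hausdorff_premeasure (f ` X) d' s \<delta>" for s \<delta>
    using f d by (rule hausdorff_premeasure_pullback_le)
  have le: "hausdorff_measure X d s \<le> hausdorff_measure (f ` X) d' s" for s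
    unfolding hausdorff_measure_def by (rule SUP_subset_mono[OF order_refl pre])
  have "hausdorff_measure X d s = 0" if "hausdorff_measure (f ` X) d' s = 0" for s
    using le[of s] unfolding that by (simp only: le_zero_eq)
  then have "{s. 0 < s \<and> hausdorff_measure (f ` X) d' s = 0} \<subseteq> {s. 0 < s \<and> hausdorff_measure X d s = 0}"
    by blast
  then show ?thesis
    unfolding hausdorff_dim_def by (rule INF_superset_mono) (rule order_refl)
qed

lemma conformal_dim_le:
  fixes f :: "'a \<Rightarrow> 'b"
  assumes Y: "Metric_space Y dY" and f: "quasisymmetric X dX Y dY f"
  shows "conformal_dim X dX \<le> hausdorff_dim (f ` X) dY"
proof -
  interpret Y: Metric_space Y dY by (rule Y)
  have fX: "f ` X \<subseteq> Y" and inj: "inj_on f X"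
    using f by (auto simp: quasisymmetric_def quasisymmetric_wrt_def)
  define d where "d x y = dY (f x) (f y)" for x y
  have "Metric_space X d"
  proof unfold_locales
    fix x y z assume xy: "x \<in> X" "y \<in> X"
    then show "d x y = 0 \<longleftrightarrow> x = y"
      unfolding d_def using fX inj by (subst Y.zero) (auto simp: inj_on_eq_iff)
    assume "z \<in> X"
    with xy show "d x z \<le> d x y + d y z"
      unfolding d_def using fX by (intro Y.triangle) auto
  qed (unfold d_def, rule Y.nonneg, rule Y.commute)
  moreover have "quasisymmetric X dX X d id"
    using f unfolding quasisymmetric_def quasisymmetric_wrt_def d_def
    by (elim exE conjE, intro exI conjI) simp_all
  ultimately have "Metric_space X d \<and> quasisymmetric X dX X d id" ..
  then have "conformal_dim X dX \<le> hausdorff_dim (id ` X) d"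
    unfolding conformal_dim_def
    by (intro Inf_lower CollectI exI[of _ id] exI[of _ X] exI[of _ d] conjI[OF refl])
  also have "\<dots> = hausdorff_dim X d" by (simp only: image_id id_apply)
  also have "\<dots> \<le> hausdorff_dim (f ` X) dY"
    by (rule hausdorff_dim_pullback_le[OF inj]) (rule d_def)
  finally show ?thesis .
qed

section \<open>Uniform disconnectedness\<close>

definition delta_sequence ::
    "'a set \<Rightarrow> ('a \<Rightarrow> 'a \<Rightarrow> real) \<Rightarrow> real \<Rightarrow> nat \<Rightarrow> (nat \<Rightarrow> 'a) \<Rightarrow> bool" where
  "delta_sequence X \<rho> \<delta>\<^sub>0 n x \<longleftrightarrow>
     1 \<le> n \<and> x ` {0..n} \<subseteq> X \<and> inj_on x {0..n} \<and>
     (\<forall>i<n. \<rho> (x i) (x (Suc i)) \<le> \<delta>\<^sub>0 * \<rho> (x 0) (x n))"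

definition uniformly_disconnected :: "'a set \<Rightarrow> ('a \<Rightarrow> 'a \<Rightarrow> real) \<Rightarrow> bool" where
  "uniformly_disconnected X \<rho> \<longleftrightarrow> (\<exists>\<delta>\<^sub>0>0. \<not> (\<exists>n x. delta_sequence X \<rho> \<delta>\<^sub>0 n x))"

section \<open>Self-affine sponges of Lalley-Gatzouras type\<close>

text \<open>The coordinates \<open>1, \<dots>, d\<close> are the elements of a finite linearly ordered index type
  \<open>'n\<close> (so \<open>d = CARD('n) \<ge> 1\<close>). The IFS consists of the maps \<open>diag_map (T k) (b k)\<close>,
  \<open>k \<in> {1..N}\<close>, where the vector \<open>T k\<close> is the diagonal of the linear part.\<close>

definition diag_map :: "real ^ 'n \<Rightarrow> real ^ 'n \<Rightarrow> real ^ 'n \<Rightarrow> real ^ 'n" where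
  "diag_map t c x = (\<chi> i. t $ i * x $ i + c $ i)"

definition diagonal_ifs :: "nat \<Rightarrow> (nat \<Rightarrow> real ^ 'n) \<Rightarrow> bool" where
  "diagonal_ifs N T \<longleftrightarrow> (\<forall>k\<in>{1..N}. \<forall>i. 0 < T k $ i \<and> T k $ i < 1)"

text \<open>By Hutchinson's theorem at most one set \<open>K\<close> satisfies the following.\<close>

definition is_attractor ::
    "nat \<Rightarrow> (nat \<Rightarrow> real ^ 'n) \<Rightarrow> (nat \<Rightarrow> real ^ 'n) \<Rightarrow> (real ^ 'n) set \<Rightarrow> bool" where
  "is_attractor N T b K \<longleftrightarrow>
     compact K \<and> K \<noteq> {} \<and> K = (\<Union>k\<in>{1..N}. diag_map (T k) (b k) ` K)"

definition coordinate_ordering ::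
    "nat \<Rightarrow> (nat \<Rightarrow> real ^ 'n::{finite,linorder}) \<Rightarrow> bool" where
  "coordinate_ordering N T \<longleftrightarrow> (\<forall>k\<in>{1..N}. \<forall>i j. i < j \<longrightarrow> T k $ j < T k $ i)"

text \<open>The space of the first \<open>i\<close> coordinates is modelled by the extensional functions on
  \<open>{..i}\<close>. The projected maps are extensional on that space, so that they are equal as elements
  of \<open>projected_ifs\<close> iff they agree there.\<close>

definition projected_ifs ::
    "nat \<Rightarrow> (nat \<Rightarrow> real ^ 'n::{finite,linorder}) \<Rightarrow> (nat \<Rightarrow> real ^ 'n::{finite,linorder}) \<Rightarrow> 'n::{finite,linorder} \<Rightarrow>
     (('n::{finite,linorder} \<Rightarrow> real) \<Rightarrow> ('n::{finite,linorder} \<Rightarrow> real)) set" where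
  "projected_ifs N T b i =
     (\<lambda>k. \<lambda>y\<in>({..i} \<rightarrow>\<^sub>E UNIV). \<lambda>j\<in>{..i}. T k $ j * y j + b k $ j) ` {1..N}"

definition open_cube :: "'n::{finite,linorder} \<Rightarrow> ('n::{finite,linorder} \<Rightarrow> real) set" where
  "open_cube i = {..i} \<rightarrow>\<^sub>E {0<..<1}"

definition neat_projection ::
    "nat \<Rightarrow> (nat \<Rightarrow> real ^ 'n::{finite,linorder}) \<Rightarrow> (nat \<Rightarrow> real ^ 'n::{finite,linorder}) \<Rightarrow> bool" where
  "neat_projection N T b \<longleftrightarrow>
     (\<forall>i. (\<forall>f \<in> projected_ifs N T b i. f ` open_cube i \<subseteq> open_cube i) \<and>
          disjoint_family_on (\<lambda>f. f ` open_cube i) (projected_ifs N T b i))"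

definition lalley_gatzouras_sponge ::
    "nat \<Rightarrow> (nat \<Rightarrow> real ^ 'n::{finite,linorder}) \<Rightarrow> (nat \<Rightarrow> real ^ 'n::{finite,linorder}) \<Rightarrow> (real ^ 'n::{finite,linorder}) set \<Rightarrow> bool" where
  "lalley_gatzouras_sponge N T b K \<longleftrightarrow>
     diagonal_ifs N T \<and> is_attractor N T b K \<and> K \<subseteq> {x. \<forall>i. 0 \<le> x $ i \<and> x $ i \<le> 1} \<and>
     coordinate_ordering N T \<and> neat_projection N T b"

end

theory Submission
  imports Defs
begin

text \<open>
  \<^emph>\<open>Uniformly disconnected implies dimension 0.\<close> If there are no \<open>\<delta>\<close>-sequences, then the chain distance
  (the least mesh of a chain joining two points) is an ultrametric that is bi-Lipschitz to the given metric.
  All its powers \<open>\<rho>\<^sup>n\<close> are metrics, quasisymmetrically equivalent to the original one, and a grid cover shows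
  that their Hausdorff dimension is at most \<open>d / n\<close>.

  \<^emph>\<open>The dichotomy.\<close> The fibre of \<open>\<Phi>\<close> in direction \<open>i\<close> over a map \<open>g\<close> of the projected system in the coordinates
  below \<open>i\<close> consists of the intervals in direction \<open>i\<close> of the maps that project to \<open>g\<close>. Either every fibre leaves a
  gap in \<open>[0,1]\<close>, or some fibre covers \<open>[0,1]\<close>.

  \<^emph>\<open>All fibres have gaps.\<close> By induction on \<open>i\<close>, every point has, at every scale, a neighbourhood in \<open>K\<close> that is well
  separated from the rest in the first \<open>i\<close> coordinates. Given such a neighbourhood for the coordinates below
  \<open>i\<close>, the neat projection condition shows that it meets boundedly many columns of the appropriate size. The gaps of
  these columns can be nested one after the other, so that there is a gap common to all of them above and below the
  given point. Hence \<open>K\<close> is uniformly disconnected.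

  \<^emph>\<open>Some fibre is full.\<close> The points of \<open>K\<close> over the fixed point of \<open>g\<close> form a set whose \<open>i\<close>-th coordinate takes all
  values in \<open>[0,1]\<close>. By the coordinate ordering, its cylinders of high level are arbitrarily flat in the remaining
  directions, so they look like segments: a quasisymmetric image of a flat cylinder \<open>w\<close> with end points at distance
  \<open>D w\<close> is joined by a chain of \<open>m\<close> smaller, mutually separated cylinders with
  \<open>D w \<le> C * (\<Sum>p. D (w' p))\<close>, where \<open>C\<close> does not depend on \<open>m\<close> and \<open>D (w' p) / D w\<close> is small for large \<open>m\<close>.
  So \<open>D w powr s \<le> (\<Sum>p. D (w' p) powr s)\<close> for each \<open>s < 1\<close>, which bounds the \<open>s\<close>-dimensional Hausdorff measure of the
  image away from 0. Thus the conformal dimension is at least 1.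
\<close>

section \<open>Hausdorff measure\<close>

lemma ediam_le_ennreal:
  assumes "0 \<le> r" "\<And>x y. x \<in> U \<Longrightarrow> y \<in> U \<Longrightarrow> d x y \<le> r"
  shows "ediam d U \<le> ennreal r"
  unfolding ediam_def by (intro SUP_least) (simp add: assms)

text \<open>The bound \<open>r\<close> keeps \<open>ediam d U\<close> finite;
  \<open>enn2real\<close> sends \<open>top\<close> to 0, which could make the estimate
  false.\<close>

lemma le_enn2real_ediam:
  assumes "ediam d U \<le> ennreal r" "x \<in> U" "y \<in> U" 
  shows "d x y \<le> enn2real (ediam d U)"
proof -
  have "ediam d U \<noteq> top" using assms(1) by (metis ennreal_less_top linorder_not_less top.not_eq_extremum)
  moreover have "ennreal (d x y) \<le> ediam d U"
    unfolding ediam_def using assms(2,3) by (meson SUP_upper2 order_refl)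
  ultimately have "enn2real (ennreal (d x y)) \<le> enn2real (ediam d U)"
    by (intro enn2real_mono) (auto simp: top.not_eq_extremum)
  then show ?thesis
    by (cases "0 \<le> d x y") (auto intro: order_trans[OF _ enn2real_nonneg])
qed

text \<open>A finite cover becomes a sequence by padding with empty sets, which cost nothing because
  \<open>0 powr s = 0\<close>. One number \<open>e\<close> bounds both mesh and cost, so all
  premeasures vanish.\<close>

lemma hausdorff_measure_eq_0I:
  fixes d :: "'a \<Rightarrow> 'a \<Rightarrow> real"
  assumes s: "0 < s"
    and cover: "\<And>e::real. 0 < e \<Longrightarrow> \<exists>(I::'i set) U r. finite I \<and> X = (\<Union>i\<in>I. U i) \<and> 0 \<le> r \<and> r \<le> e \<and>
      (\<forall>i\<in>I. \<forall>x\<in>U i. \<forall>y\<in>U i. d x y \<le> r) \<and> real (card I) * r powr s \<le> e"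
  shows "hausdorff_measure X d s = 0"
proof -
  have "hausdorff_premeasure X d s \<delta> \<le> 0 + ennreal \<epsilon>" if \<delta>: "0 < \<delta>" and \<epsilon>: "0 < \<epsilon>" for \<delta> \<epsilon> :: real
  proof -
    obtain I :: "'i set" and U r where I: "finite I" "X = (\<Union>i\<in>I. U i)" "0 \<le> r" "r \<le> min \<delta> \<epsilon>"
      "\<And>i x y. i \<in> I \<Longrightarrow> x \<in> U i \<Longrightarrow> y \<in> U i \<Longrightarrow> d x y \<le> r" "real (card I) * r powr s \<le> min \<delta> \<epsilon>"
      using cover[of "min \<delta> \<epsilon>"] \<delta> \<epsilon> by (metis min_less_iff_conj)
    obtain h where h: "bij_betw h {0..<card I} I" using ex_bij_betw_nat_finite[OF I(1)] ..
    define V where "V m = (if m < card I then U (h m) else {})" for m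
    have dV: "ediam d (V m) \<le> ennreal r" for m
    proof (rule ediam_le_ennreal[OF I(3)])
      fix x y assume "x \<in> V m" "y \<in> V m"
      then show "d x y \<le> r"
        using I(5)[of "h m" x y] bij_betwE[OF h] by (auto simp: V_def split: if_splits)
    qed
    have "(\<Union>m. V m) = (\<Union>m\<in>{0..<card I}. U (h m))" by (auto simp: V_def split: if_splits)
    also have "\<dots> = (\<Union>i\<in>h ` {0..<card I}. U i)" by simp
    also have "\<dots> = X" unfolding I(2) bij_betw_imp_surj_on[OF h] ..
    finally have VX: "X = (\<Union>m. V m)" ..
    have "hausdorff_premeasure X d s \<delta> \<le> (\<Sum>m. ennreal (enn2real (ediam d (V m)) powr s))"
      unfolding hausdorff_premeasure_def
      by (rule INF_lower) (use VX dV I(4) in \<open>auto intro: order_trans ennreal_leI\<close>)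
    also have "\<dots> = (\<Sum>m<card I. ennreal (enn2real (ediam d (V m)) powr s))"
      by (rule suminf_finite) (use s in \<open>auto simp: V_def ediam_def bot_ennreal\<close>)
    also have "\<dots> \<le> (\<Sum>m<card I. ennreal (r powr s))"
    proof (intro sum_mono ennreal_leI powr_mono2)
      fix m show "enn2real (ediam d (V m)) \<le> r"
        using enn2real_mono[OF dV] I(3) by (simp add: enn2real_ennreal)
    qed (use s in auto)
    also have "\<dots> = ennreal (real (card I) * r powr s)"
      by (simp add: ennreal_mult' ennreal_of_nat_eq_real_of_nat)
    also have "\<dots> \<le> ennreal \<epsilon>" using I(6) by (intro ennreal_leI) simp
    finally show ?thesis by simp
  qed
  then have le: "hausdorff_premeasure X d s \<delta> \<le> 0" if "0 < \<delta>" for \<delta>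
    using that by (metis ennreal_le_epsilon)
  have "hausdorff_measure X d s \<le> 0"
    unfolding hausdorff_measure_def by (rule SUP_least) (rule le, simp)
  then show ?thesis by simp
qed

text \<open>A cover of cost below \<open>c / 2\<close> gets strictly positive weights by adding a
  geometric series of sum \<open>c / 2\<close>, and the total stays below \<open>c\<close>. Positive
  weights let \<open>no_cheap_cover\<close> reach its contradiction at a single cover set.\<close>

lemma hausdorff_measure_neq_0I:
  fixes d :: "'a \<Rightarrow> 'a \<Rightarrow> real"
  assumes s: "0 < s" and c: "0 < c"
    and nonneg: "\<And>x y. 0 \<le> d x y"
    and ge: "\<And>U a. X \<subseteq> (\<Union>n. U n) \<Longrightarrow> (\<And>n. 0 < a n) \<Longrightarrow> summable a \<Longrightarrow>
      (\<And>n x y. x \<in> U n \<Longrightarrow> y \<in> U n \<Longrightarrow> d x y powr s \<le> a n) \<Longrightarrow> c \<le> suminf a"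
  shows "hausdorff_measure X d s \<noteq> 0"
proof
  assume "hausdorff_measure X d s = 0"
  then have "hausdorff_premeasure X d s 1 \<le> 0"
    unfolding hausdorff_measure_def by (metis SUP_upper greaterThan_iff zero_less_one)
  then have "hausdorff_premeasure X d s 1 < ennreal (c / 2)" using c by (simp add: le_less_trans)
  then obtain U where U: "X = (\<Union>n. U n)" "\<And>n. ediam d (U n) \<le> ennreal 1"
    and lt: "(\<Sum>n. ennreal (enn2real (ediam d (U n)) powr s)) < ennreal (c / 2)"
    unfolding hausdorff_premeasure_def by (auto simp: INF_less_iff)
  define e where "e n = enn2real (ediam d (U n)) powr s" for n
  have e0: "0 \<le> e n" for n by (simp add: e_def)
  have e_sum: "summable e"
    by (rule summable_suminf_not_top[OF e0]) (use lt in \<open>auto simp: e_def top_unique\<close>)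
  have "(\<Sum>n. ennreal (e n)) < ennreal (c / 2)" using lt by (simp only: e_def)
  then have "ennreal (suminf e) < ennreal (c / 2)" by (simp only: suminf_ennreal2[OF e0 e_sum])
  then have e_lt: "suminf e < c / 2" using c by (simp add: ennreal_less_iff suminf_nonneg[OF e_sum e0])
  define a where "a n = e n + c / 2 * (1 / 2) ^ Suc n" for n
  have geo: "(\<lambda>n. c / 2 * (1 / 2) ^ Suc n) sums (c / 2)"
    using sums_mult[OF power_half_series, of "c / 2"] by simp
  have a_sums: "a sums (suminf e + c / 2)"
    unfolding a_def by (rule sums_add[OF summable_sums[OF e_sum] geo])
  have "c \<le> suminf a"
  proof (rule ge)
    show "X \<subseteq> (\<Union>n. U n)" using U(1) by simp
    show "summable a" using a_sums by (rule sums_summable)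
    show "0 < a n" for n using c e0 by (simp add: a_def add_nonneg_pos)
    fix n x y assume xy: "x \<in> U n" "y \<in> U n"
    have "d x y \<le> enn2real (ediam d (U n))" using U(2) xy by (rule le_enn2real_ediam)
    then have "d x y powr s \<le> e n" unfolding e_def using s nonneg by (intro powr_mono2) auto
    also have "\<dots> \<le> a n" using c by (simp add: a_def)
    finally show "d x y powr s \<le> a n" .
  qed
  then show False using e_lt sums_unique[OF a_sums] by simp
qed

lemma hausdorff_dim_le_if_null:
  "0 < s \<Longrightarrow> hausdorff_measure X d s = 0 \<Longrightarrow> hausdorff_dim X d \<le> ennreal s"
  unfolding hausdorff_dim_def by (rule INF_lower) simp

lemma dist_le_card:
  fixes x y :: "real ^ 'n"
  assumes "\<And>j. \<bar>x $ j - y $ j\<bar> \<le> r"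
  shows "dist x y \<le> real CARD('n) * r"
proof -
  have "dist x y \<le> (\<Sum>j\<in>UNIV. \<bar>x $ j - y $ j\<bar>)"
    using norm_le_l1_cart[of "x - y"] by (simp add: dist_norm)
  also have "\<dots> \<le> (\<Sum>j\<in>(UNIV::'n set). r)" by (intro sum_mono assms)
  finally show ?thesis by simp
qed

section \<open>Chains and ultrametrics\<close>

definition linked :: "'a::metric_space set \<Rightarrow> real \<Rightarrow> 'a \<Rightarrow> 'a \<Rightarrow> bool" where
  "linked X e = (\<lambda>x y. x \<in> X \<and> y \<in> X \<and> dist x y \<le> e)\<^sup>*\<^sup>*"

text \<open>This is the subdominant ultrametric. The condition \<open>0 \<le> e\<close> matters for
  \<open>x = y\<close>: the reflexive closure links a point to itself even for negative
  \<open>e\<close>.\<close>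

definition chain_dist :: "'a::metric_space set \<Rightarrow> 'a \<Rightarrow> 'a \<Rightarrow> real" where
  "chain_dist X x y = Inf {e. 0 \<le> e \<and> linked X e x y}"

lemma linked_sym: "linked X e x y \<Longrightarrow> linked X e y x"
  unfolding linked_def by (rule sympD[OF symp_rtranclp]) (auto simp: symp_def dist_commute)

lemma linked_mono: "linked X a x y \<Longrightarrow> a \<le> b \<Longrightarrow> linked X b x y"
  unfolding linked_def by (erule rtranclp_mono[THEN predicate2D, rotated]) auto

lemma linked_trans:
  assumes "linked X e x y" "linked X e' y z"
  shows "linked X (max e e') x z"
  using linked_mono[OF assms(1), of "max e e'"] linked_mono[OF assms(2), of "max e e'"]
  unfolding linked_def by simp

lemma linked_if_dist_le: "x \<in> X \<Longrightarrow> y \<in> X \<Longrightarrow> dist x y \<le> e \<Longrightarrow> linked X e x y"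
  unfolding linked_def by blast

lemma chain_dist_commute: "chain_dist X x y = chain_dist X y x"
  unfolding chain_dist_def by (rule arg_cong[where f=Inf]) (auto intro: linked_sym)

lemma chain_dist_le: "0 \<le> e \<Longrightarrow> linked X e x y \<Longrightarrow> chain_dist X x y \<le> e"
  unfolding chain_dist_def by (rule cInf_lower) (auto intro: bdd_belowI)

lemma chain_dist_le_dist: "x \<in> X \<Longrightarrow> y \<in> X \<Longrightarrow> chain_dist X x y \<le> dist x y"
  by (intro chain_dist_le linked_if_dist_le) auto

lemma ex_linked: "x \<in> X \<Longrightarrow> y \<in> X \<Longrightarrow> \<exists>e\<ge>0. linked X e x y"
  by (intro exI[of _ "dist x y"]) (simp add: linked_if_dist_le)

lemma chain_dist_nonneg: "x \<in> X \<Longrightarrow> y \<in> X \<Longrightarrow> 0 \<le> chain_dist X x y"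
  unfolding chain_dist_def by (rule cInf_greatest) (auto dest: ex_linked)

text \<open>A concatenation of chains has the larger of the two meshes. The infimum need not be
  attained, so the bound is shown for every \<open>e\<close> above the maximum.\<close>

lemma chain_dist_ultra:
  assumes "x \<in> X" "y \<in> X" "z \<in> X"
  shows "chain_dist X x z \<le> max (chain_dist X x y) (chain_dist X y z)"
proof (rule dense_ge)
  fix e assume e: "max (chain_dist X x y) (chain_dist X y z) < e"
  have *: "\<exists>a<e. 0 \<le> a \<and> linked X a u v" if "chain_dist X u v < e" "u \<in> X" "v \<in> X" for u v
    using cInf_lessD[of "{e. 0 \<le> e \<and> linked X e u v}" e] that ex_linked[of u X v]
    by (auto simp: chain_dist_def)
  obtain a a' where "a < e" "0 \<le> a" "linked X a x y" "a' < e" "0 \<le> a'" "linked X a' y z"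
    using * [of x y] *[of y z] e assms by auto
  then have "chain_dist X x z \<le> max a a'" by (intro chain_dist_le linked_trans) auto
  then show "chain_dist X x z \<le> e" using \<open>a < e\<close> \<open>a' < e\<close> by linarith
qed

text \<open>A shortest chain consists of distinct points.\<close>

lemma linked_imp_delta_sequence:
  assumes l: "linked X e x y" and xy: "x \<noteq> y" and e: "e \<le> \<delta> * dist x y"
  shows "\<exists>n p. delta_sequence X dist \<delta> n p"
proof -
  define R where "R = (\<lambda>x y. x \<in> X \<and> y \<in> X \<and> dist x y \<le> e)"
  define n where "n = (LEAST n. (R ^^ n) x y)"
  have "\<exists>n. (R ^^ n) x y" using l unfolding linked_def R_def by (simp add: rtranclp_power)
  then have n: "(R ^^ n) x y" unfolding n_def by (rule LeastI_ex)
  have min: "n \<le> m" if "(R ^^ m) x y" for m unfolding n_def using that by (rule Least_le)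
  obtain p where p: "p 0 = x" "p n = y" "\<And>i. i < n \<Longrightarrow> R (p i) (p (Suc i))"
    using n by (auto simp: relpowp_fun_conv)
  have n1: "1 \<le> n" using p xy by (cases n) auto
  \<comment> \<open>Segments of the shortest chain are chains, so a loop in it could be cut out,
    leaving a shorter chain.\<close>
  have "(R ^^ k) (p a) (p (a + k))" if "a + k \<le> n" for a k
    using that by (induction k) (auto intro!: relcomppI p(3))
  note seg = this
  have "p a \<noteq> p c" if "a < c" "c \<le> n" for a c
  proof
    assume "p a = p c"
    then have "(R ^^ (a + (n - c))) x y"
      using seg[of 0 a] seg[of c "n - c"] that p by (subst relpowp_add) auto
    from min[OF this] that show False by simp
  qed
  then have inj: "inj_on p {0..n}"
    by (metis atLeastAtMost_iff inj_onI linorder_less_linear)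
  have "p i \<in> X" if "i \<le> n" for i
    using that p(3)[of i] p(3)[of "i - 1"] n1 by (cases "i < n") (auto simp: R_def)
  then have "p ` {0..n} \<subseteq> X" by auto
  then have "delta_sequence X dist \<delta> n p"
    unfolding delta_sequence_def using n1 inj p e by (auto simp: R_def intro: order_trans)
  then show ?thesis by blast
qed

text \<open>A smaller admissible mesh would produce a delta-sequence. With
  \<open>chain_dist_le_dist\<close> this makes the chain distance bi-Lipschitz to
  \<open>dist\<close>.\<close>

lemma chain_dist_ge:
  assumes ud: "\<not> (\<exists>n p. delta_sequence X dist \<delta> n p)" and "x \<in> X" "y \<in> X"
  shows "\<delta> * dist x y \<le> chain_dist X x y"
proof (cases "x = y")
  case False
  show ?thesis unfolding chain_dist_def
  proof (rule cInf_greatest)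
    show "{e. 0 \<le> e \<and> linked X e x y} \<noteq> {}"
      using linked_if_dist_le[OF assms(2,3) order_refl] by (auto intro!: exI[of _ "dist x y"])
    fix e assume "e \<in> {e. 0 \<le> e \<and> linked X e x y}"
    then show "\<delta> * dist x y \<le> e" using linked_imp_delta_sequence[of X e x y \<delta>] ud False
      by (metis (no_types, lifting) linorder_linear mem_Collect_eq)
  qed
qed (simp add: chain_dist_nonneg assms)

text \<open>Powers of an ultrametric satisfy the triangle inequality because the maximum of two
  powers is at most their sum. The absolute value is there because \<open>Metric_space\<close>
  demands nonnegativity on the whole type, also outside \<open>X\<close>.\<close>

lemma Metric_space_chain_dist_power:
  assumes ud: "\<not> (\<exists>n p. delta_sequence X dist \<delta> n p)" and \<delta>: "0 < \<delta>" and n: "0 < n"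
  shows "Metric_space X (\<lambda>x y. \<bar>chain_dist X x y\<bar> ^ n)"
proof
  fix x y :: 'a
  show "0 \<le> \<bar>chain_dist X x y\<bar> ^ n" by simp
  show "\<bar>chain_dist X x y\<bar> ^ n = \<bar>chain_dist X y x\<bar> ^ n" by (simp add: chain_dist_commute)
  assume xy: "x \<in> X" "y \<in> X"
  have "chain_dist X x y = 0 \<longleftrightarrow> x = y"
    using chain_dist_ge[OF ud xy] chain_dist_le_dist[OF xy] chain_dist_nonneg[OF xy] \<delta>
    by (metis dist_eq_0_iff dist_pos_lt linorder_not_less mult_pos_pos order_antisym)
  then show "\<bar>chain_dist X x y\<bar> ^ n = 0 \<longleftrightarrow> x = y" using n by simp
  fix z assume z: "z \<in> X"
  have "\<bar>chain_dist X x z\<bar> ^ n \<le> (max \<bar>chain_dist X x y\<bar> \<bar>chain_dist X y z\<bar>) ^ n"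
    using chain_dist_ultra[OF xy z] xy z by (intro power_mono) (simp_all add: chain_dist_nonneg)
  also have "\<dots> \<le> \<bar>chain_dist X x y\<bar> ^ n + \<bar>chain_dist X y z\<bar> ^ n"
    by (auto simp: max_def)
  finally show "\<bar>chain_dist X x z\<bar> ^ n \<le> \<bar>chain_dist X x y\<bar> ^ n + \<bar>chain_dist X y z\<bar> ^ n" .
qed

lemma homeomorphism_scaled_power:
  fixes c :: real
  assumes "0 < c" "0 < n"
  shows "homeomorphism {0..} {0..} (\<lambda>t. (t / c) ^ n) (\<lambda>u. c * root n u)"
  using assms
  by (intro homeomorphismI continuous_intros) (auto simp: real_root_pos2 real_root_power_cancel)

text \<open>The bi-Lipschitz bounds, upper for the numerator and lower for the denominator, change a
  ratio of distances by at most \<open>1 / \<delta>\<close>.\<close>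

lemma quasisymmetric_chain_dist_power:
  assumes ud: "\<not> (\<exists>n p. delta_sequence X dist \<delta> n p)" and \<delta>: "0 < \<delta>" and n: "0 < n"
  shows "quasisymmetric X dist X (\<lambda>x y. \<bar>chain_dist X x y\<bar> ^ n) id"
proof -
  have ratio: "\<bar>chain_dist X x y\<bar> ^ n / \<bar>chain_dist X y z\<bar> ^ n \<le> (t / \<delta>) ^ n"
    if "x \<in> X" "y \<in> X" "z \<in> X" "y \<noteq> z" "dist x y / dist y z \<le> t" for x y z t
  proof -
    have "chain_dist X x y / chain_dist X y z \<le> dist x y / (\<delta> * dist y z)"
      using that \<delta> by (intro frac_le chain_dist_le_dist chain_dist_ge[OF ud]) auto
    also have "\<dots> \<le> t / \<delta>" using that \<delta> by (simp add: field_simps)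
    finally have "\<bar>chain_dist X x y / chain_dist X y z\<bar> \<le> t / \<delta>"
      using that by (simp add: chain_dist_nonneg)
    then have "\<bar>chain_dist X x y / chain_dist X y z\<bar> ^ n \<le> (t / \<delta>) ^ n"
      by (rule power_mono) simp
    then show ?thesis by (simp only: abs_divide power_divide)
  qed
  have "quasisymmetric_wrt (\<lambda>t. (t / \<delta>) ^ n) X dist X (\<lambda>x y. \<bar>chain_dist X x y\<bar> ^ n) id"
    unfolding quasisymmetric_wrt_def id_apply
    by (intro conjI ballI allI impI ratio) auto
  with homeomorphism_scaled_power[OF \<delta> n] show ?thesis
    unfolding quasisymmetric_def by blast
qed

section \<open>Hausdorff dimension of powers of a metric on the unit cube\<close>

text \<open>A grid of mesh \<open>1 / M\<close> has \<open>(M + 1) ^ CARD('n)\<close> cells of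
  \<open>d\<close>-diameter at most \<open>(D / M) ^ n\<close>. The cost is of order
  \<open>M powr (D - n * s)\<close>, and the surplus 1 in the second bound on \<open>s\<close> makes
  it decay at least like \<open>1 / M\<close>.\<close>

lemma hausdorff_dim_power_le:
  fixes X :: "(real ^ 'n) set"
  assumes cube: "X \<subseteq> {x. \<forall>i. 0 \<le> x $ i \<and> x $ i \<le> 1}"
    and d: "\<And>x y. x \<in> X \<Longrightarrow> y \<in> X \<Longrightarrow> d x y \<le> dist x y ^ n"
    and s: "0 < s" "real CARD('n) + 1 \<le> real n * s"
  shows "hausdorff_dim X d \<le> ennreal s"
proof (rule hausdorff_dim_le_if_null[OF s(1)], rule hausdorff_measure_eq_0I[OF s(1)])
  fix e :: real assume e: "0 < e"
  define D where "D = real CARD('n)"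
  have D: "1 \<le> D" unfolding D_def by (simp add: Suc_leI)
  have n: "0 < n" using s D unfolding D_def by (cases n) auto
  have "((\<lambda>M. (D / real M) ^ n) \<longlonglongrightarrow> 0)"
    using n by (auto intro!: tendsto_eq_intros lim_const_over_n)
  then have ev1: "eventually (\<lambda>M. (D / real M) ^ n < e) sequentially"
    by (rule order_tendstoD) (use e in simp)
  have lim: "(\<lambda>M. 2 powr D * D powr (real n * s) * inverse (real M)) \<longlonglongrightarrow> 0"
    by (intro tendsto_mult_right_zero tendsto_inverse_0_at_top filterlim_real_sequentially)
  have ev2: "eventually (\<lambda>M. 2 powr D * D powr (real n * s) * inverse (real M) < e) sequentially"
    using order_tendstoD(2)[OF lim e] .
  obtain M :: nat where M: "(D / real M) ^ n < e" "2 powr D * D powr (real n * s) * inverse (real M) < e" "1 \<le> M"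
    using eventually_happens[OF eventually_conj[OF eventually_conj[OF ev1 ev2] eventually_ge_at_top[of "1::nat"]]] by auto
  \<comment> \<open>The index \<open>M\<close> itself is included for points with a coordinate equal
    to 1.\<close>
  define I where "I = (UNIV :: 'n set) \<rightarrow>\<^sub>E {..M}"
  define U where "U g = {x\<in>X. \<forall>j. g j = nat \<lfloor>real M * x $ j\<rfloor>}" for g :: "'n \<Rightarrow> nat"
  have dU: "d x y \<le> (D / real M) ^ n" if "x \<in> U g" "y \<in> U g" for g x y
  proof -
    have "\<bar>x $ j - y $ j\<bar> \<le> 1 / real M" for j
    proof -
      have nn: "0 \<le> real M * x $ j" "0 \<le> real M * y $ j" using that cube by (auto simp: U_def)
      have "nat \<lfloor>real M * x $ j\<rfloor> = nat \<lfloor>real M * y $ j\<rfloor>" using that unfolding U_def by auto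
      then have "\<lfloor>real M * x $ j\<rfloor> = \<lfloor>real M * y $ j\<rfloor>" using nn by (simp add: eq_nat_nat_iff)
      then have "\<bar>real M * x $ j - real M * y $ j\<bar> \<le> 1" by linarith
      then have "real M * \<bar>x $ j - y $ j\<bar> \<le> 1" by (simp add: abs_mult flip: right_diff_distrib)
      then show ?thesis using M(3) by (simp add: field_simps)
    qed
    from dist_le_card[OF this] have "dist x y \<le> D / real M" by (simp add: D_def)
    then have "dist x y ^ n \<le> (D / real M) ^ n" by (intro power_mono) auto
    then show ?thesis using d[of x y] that unfolding U_def by auto
  qed
  have XU: "X = (\<Union>g\<in>I. U g)"
  proof (intro equalityI subsetI)
    fix x assume x: "x \<in> X"
    have "nat \<lfloor>real M * x $ j\<rfloor> \<le> M" for j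
    proof -
      have "real M * x $ j \<le> real M * 1" using x cube by (intro mult_left_mono) auto
      then show ?thesis by (simp add: nat_le_iff floor_le_iff)
    qed
    then show "x \<in> (\<Union>g\<in>I. U g)" using x
      by (auto intro!: bexI[of _ "\<lambda>j. nat \<lfloor>real M * x $ j\<rfloor>"] simp: U_def I_def)
  qed (auto simp: U_def)
  have cI: "real (card I) \<le> 2 powr D * real M powr D"
  proof -
    have "real (card I) = (real M + 1) ^ CARD('n)" unfolding I_def by (simp add: card_PiE add.commute)
    also have "\<dots> \<le> (2 * real M) ^ CARD('n)" using M(3) by (intro power_mono) auto
    also have "\<dots> = 2 powr D * real M powr D"
      using M(3) by (simp add: D_def powr_realpow power_mult_distrib)
    finally show ?thesis .
  qed
  have "real (card I) * ((D / real M) ^ n) powr s \<le> 2 powr D * real M powr D * (D powr (real n * s) * real M powr (- (D + 1)))"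
  proof (intro mult_mono cI)
    have "((D / real M) ^ n) powr s = (D / real M) powr (real n * s)"
      using D M(3) by (simp add: powr_powr flip: powr_realpow)
    also have "\<dots> = D powr (real n * s) * real M powr (- (real n * s))"
      using D M(3) by (simp add: powr_divide powr_minus_divide)
    also have "\<dots> \<le> D powr (real n * s) * real M powr (- (D + 1))"
      using s(2) M(3) by (intro mult_left_mono powr_mono) (auto simp: D_def)
    finally show "((D / real M) ^ n) powr s \<le> D powr (real n * s) * real M powr (- (D + 1))" .
  qed auto
  also have "\<dots> = 2 powr D * D powr (real n * s) * (real M powr (D + (- (D + 1))))"
    by (subst powr_add) (simp only: mult_ac)
  also have "\<dots> = 2 powr D * D powr (real n * s) * inverse (real M)"
    using M(3) by (simp add: powr_minus)
  finally have "real (card I) * ((D / real M) ^ n) powr s \<le> e" using M(2) by linarith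
  then show "\<exists>(I::('n \<Rightarrow> nat) set) U r. finite I \<and> X = (\<Union>i\<in>I. U i) \<and> 0 \<le> r \<and> r \<le> e \<and>
      (\<forall>i\<in>I. \<forall>x\<in>U i. \<forall>y\<in>U i. d x y \<le> r) \<and> real (card I) * r powr s \<le> e"
    using XU dU M(1) D
    by (intro exI[of _ I] exI[of _ U] exI[of _ "(D / real M) ^ n"]) (auto simp: I_def intro: finite_PiE)
qed

lemma conformal_dim_eq_0_if_uniformly_disconnected:
  fixes X :: "(real ^ 'n) set"
  assumes cube: "X \<subseteq> {x. \<forall>i. 0 \<le> x $ i \<and> x $ i \<le> 1}" and "uniformly_disconnected X dist"
  shows "conformal_dim X dist = 0"
proof -
  obtain \<delta> where \<delta>: "0 < \<delta>" and ud: "\<not> (\<exists>n p. delta_sequence X dist \<delta> n p)"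
    using assms(2) unfolding uniformly_disconnected_def by blast
  have "conformal_dim X dist \<le> 0 + ennreal s" if s: "0 < s" for s :: real
  proof -
    obtain n :: nat where n: "(real CARD('n) + 1) / s \<le> real n" using real_arch_simple by blast
    then have ns: "real CARD('n) + 1 \<le> real n * s" using s by (simp add: field_simps)
    then have n0: "0 < n" by (cases n) auto
    let ?d = "\<lambda>x y. \<bar>chain_dist X x y\<bar> ^ n"
    have "conformal_dim X dist \<le> hausdorff_dim (id ` X) ?d"
      using Metric_space_chain_dist_power[OF ud \<delta> n0] quasisymmetric_chain_dist_power[OF ud \<delta> n0]
      by (rule conformal_dim_le)
    also have "\<dots> \<le> ennreal s" unfolding image_id id_apply
      using cube by (rule hausdorff_dim_power_le[OF _ _ s ns])
        (auto intro!: power_mono simp: chain_dist_nonneg chain_dist_le_dist)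
    finally show ?thesis by simp
  qed
  then have "conformal_dim X dist \<le> 0" by (metis ennreal_le_epsilon)
  then show ?thesis by simp
qed

section \<open>Quasisymmetric images of flat cylinders\<close>

text \<open>A mass distribution principle that needs no measure: if the cover were too cheap, one could descend along a
  branch \<open>w\<close> such that the cover sets that meet \<open>S w\<close> always weigh less than a constant times \<open>D w powr s\<close>; no
  cover set could then contain the point in which the branch ends.\<close>

lemma no_cheap_cover:
  fixes S :: "'w \<Rightarrow> 'a::heine_borel set" and \<rho> :: "'a \<Rightarrow> 'a \<Rightarrow> real" and a :: "nat \<Rightarrow> real" and m :: nat
  assumes s: "0 < s" and g: "0 < g" and w0: "P w0"
    and compact: "\<And>w. P w \<Longrightarrow> compact (S w) \<and> S w \<noteq> {}" and pos: "\<And>w. P w \<Longrightarrow> 0 < D w"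
    and step: "\<And>w. P w \<Longrightarrow> \<exists>w'. (\<forall>p<m. P (w' p) \<and> S (w' p) \<subseteq> S w \<and> D (w' p) \<le> D w / 2) \<and>
      D w powr s \<le> (\<Sum>p<m. D (w' p) powr s) \<and>
      (\<forall>p<m. \<forall>q<m. \<forall>x\<in>S (w' p). \<forall>y\<in>S (w' q). p \<noteq> q \<longrightarrow> g * D w \<le> \<rho> x y)"
    and cover: "S w0 \<subseteq> (\<Union>n. U n)" and a: "\<And>n. 0 < a n" "summable a"
    and U: "\<And>n x y. x \<in> U n \<Longrightarrow> y \<in> U n \<Longrightarrow> \<rho> x y powr s \<le> a n"
  shows "(g * D w0) powr s \<le> suminf a"
proof (rule ccontr)
  define b where "b w n = (if U n \<inter> S w \<noteq> {} then a n else 0)" for w n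
  have b_nonneg: "0 \<le> b w n" for w n using a(1) by (simp add: b_def less_imp_le)
  have b_sum: "summable (b w)" for w
    by (rule summable_comparison_test'[OF a(2), of 0]) (use a(1) in \<open>auto simp: b_def less_imp_le\<close>)
  have b_le: "a n \<le> suminf (b w)" if "U n \<inter> S w \<noteq> {}" for w n
    using sum_le_suminf[OF b_sum, of "{n}" w] b_nonneg that by (simp add: b_def)
  define Q where "Q w \<longleftrightarrow> P w \<and> suminf (b w) < (g * D w) powr s" for w
  assume "\<not> (g * D w0) powr s \<le> suminf a"
  moreover have "suminf (b w0) \<le> suminf a"
    by (rule suminf_le[OF _ b_sum a(2)]) (use a(1) in \<open>auto simp: b_def less_imp_le\<close>)
  ultimately have Q0: "Q w0" using w0 by (simp add: Q_def)
  have next_Q: "\<exists>v. Q v \<and> S v \<subseteq> S w \<and> D v \<le> D w / 2" if w: "Q w" for w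
  proof -
    have Pw: "P w" and cost: "suminf (b w) < (g * D w) powr s" using w by (auto simp: Q_def)
    obtain w' where w': "\<And>p. p < m \<Longrightarrow> P (w' p) \<and> S (w' p) \<subseteq> S w \<and> D (w' p) \<le> D w / 2"
      and ge: "D w powr s \<le> (\<Sum>p<m. D (w' p) powr s)"
      and sep: "\<And>p q x y. p < m \<Longrightarrow> q < m \<Longrightarrow> x \<in> S (w' p) \<Longrightarrow> y \<in> S (w' q) \<Longrightarrow> p \<noteq> q \<Longrightarrow> g * D w \<le> \<rho> x y"
      using step[OF Pw] by metis
    \<comment> \<open>A cover set meeting two pieces would, by their separation, alone weigh at
      least \<open>(g * D w) powr s\<close>, more than all cover sets meeting \<open>S w\<close>
      together.\<close>
    have uniq: "p = q" if meet: "U n \<inter> S (w' p) \<noteq> {}" "U n \<inter> S (w' q) \<noteq> {}" and "p < m" "q < m" for n p q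
    proof (rule ccontr)
      assume "p \<noteq> q"
      obtain x y where xy: "x \<in> U n" "x \<in> S (w' p)" "y \<in> U n" "y \<in> S (w' q)" using meet by blast
      have "(g * D w) powr s \<le> \<rho> x y powr s"
        using sep[OF \<open>p < m\<close> \<open>q < m\<close> xy(2,4) \<open>p \<noteq> q\<close>] s g pos[OF Pw] by (intro powr_mono2) auto
      also have "\<dots> \<le> a n" using U xy by blast
      also have "\<dots> \<le> suminf (b w)" by (rule b_le) (use xy w' \<open>p < m\<close> in blast)
      finally show False using cost by simp
    qed
    have sum_b: "(\<Sum>p<m. b (w' p) n) \<le> b w n" for n
    proof (cases "\<exists>p<m. U n \<inter> S (w' p) \<noteq> {}")
      case True
      then obtain p where p: "p < m" "U n \<inter> S (w' p) \<noteq> {}" by blast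
      have "(\<Sum>q<m. b (w' q) n) = (\<Sum>q\<in>{p}. b (w' q) n)"
        by (rule sum.mono_neutral_right) (use p uniq in \<open>auto simp: b_def\<close>)
      also have "\<dots> \<le> b w n" using p w'[of p] by (auto simp: b_def)
      finally show ?thesis .
    next
      case False
      then have "(\<Sum>p<m. b (w' p) n) = 0" by (intro sum.neutral) (auto simp: b_def)
      then show ?thesis using b_nonneg by simp
    qed
    \<comment> \<open>The costs of the pieces sum to at most the cost of \<open>w\<close>, but their
      sizes to the power \<open>s\<close> sum to at least \<open>D w powr s\<close>; so some piece
      inherits the strict inequality.\<close>
    have "\<exists>p<m. suminf (b (w' p)) < (g * D (w' p)) powr s"
    proof (rule ccontr)
      assume neg: "\<not> ?thesis"
      have "(g * D w) powr s = g powr s * D w powr s" using g pos[OF Pw] by (simp add: powr_mult)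
      also have "\<dots> \<le> g powr s * (\<Sum>p<m. D (w' p) powr s)" using ge by (simp add: mult_left_mono)
      also have "\<dots> = (\<Sum>p<m. (g * D (w' p)) powr s)"
        unfolding sum_distrib_left using g w' pos by (intro sum.cong refl) (simp add: powr_mult less_imp_le)
      also have "\<dots> \<le> (\<Sum>p<m. suminf (b (w' p)))" using neg by (intro sum_mono) (meson lessThan_iff not_le)
      also have "\<dots> = (\<Sum>n. \<Sum>p<m. b (w' p) n)" by (rule suminf_sum[symmetric]) (rule b_sum)
      also have "\<dots> \<le> suminf (b w)" by (rule suminf_le[OF sum_b summable_sum b_sum]) (rule b_sum)
      finally show False using cost by simp
    qed
    then show ?thesis using w' by (auto simp: Q_def)
  qed
  obtain W where W: "\<And>n. Q (W n)" "\<And>n. S (W (Suc n)) \<subseteq> S (W n) \<and> D (W (Suc n)) \<le> D (W n) / 2" and W0: "W 0 = w0"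
    using dependent_nat_choice[of "\<lambda>n w. Q w \<and> (n = 0 \<longrightarrow> w = w0)" "\<lambda>n w v. S v \<subseteq> S w \<and> D v \<le> D w / 2"]
      Q0 next_Q by (metis nat.distinct(1))
  have PW: "P (W n)" for n using W(1) by (simp add: Q_def)
  have dec: "S (W n) \<subseteq> S (W k)" if "k \<le> n" for k n
    by (rule lift_Suc_antimono_le[OF _ that]) (use W(2) in blast)
  have "(\<Inter>(range (S \<circ> W))) \<noteq> {}"
    by (rule compact_nest) (use compact[OF PW] dec in auto)
  then obtain x where x: "\<And>n. x \<in> S (W n)" by auto
  then obtain k where k: "x \<in> U k" using cover W0 by (metis UN_iff subsetD)
  \<comment> \<open>The cover set \<open>U k\<close> meets every set of the branch, so its fixed
    positive weight stays below a bound that tends to 0.\<close>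
  have lt: "a k < (g * D (W n)) powr s" for n
  proof -
    have "a k \<le> suminf (b (W n))" by (rule b_le) (use x k in blast)
    then show ?thesis using W(1)[of n] by (simp add: Q_def)
  qed
  have Dn: "D (W n) \<le> D w0 / 2 ^ n" for n
  proof (induction n)
    case (Suc n)
    have "D (W (Suc n)) \<le> D (W n) / 2" using W(2) by blast
    also have "\<dots> \<le> D w0 / 2 ^ n / 2" using Suc by simp
    finally show ?case by (simp add: mult.commute)
  qed (simp add: W0)
  have "(\<lambda>n. D w0 * (1 / 2) ^ n) \<longlonglongrightarrow> 0"
    by (intro tendsto_mult_right_zero LIMSEQ_realpow_zero) auto
  then have "(\<lambda>n. D (W n)) \<longlonglongrightarrow> 0"
  proof (rule tendsto_sandwich[OF _ _ tendsto_const, rotated 2])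
    show "\<forall>\<^sub>F n in sequentially. 0 \<le> D (W n)" using pos[OF PW] by (simp add: less_imp_le)
    show "\<forall>\<^sub>F n in sequentially. D (W n) \<le> D w0 * (1 / 2) ^ n" using Dn by (simp add: power_one_over)
  qed
  then have "(\<lambda>n. g * D (W n)) \<longlonglongrightarrow> 0" by (rule tendsto_mult_right_zero)
  then have "(\<lambda>n. (g * D (W n)) powr s) \<longlonglongrightarrow> 0 powr s"
    by (intro tendsto_powr2) (use s g pos[OF PW] in \<open>auto intro!: always_eventually simp: less_imp_le\<close>)
  then have "eventually (\<lambda>n. (g * D (W n)) powr s < a k) sequentially"
    by (rule order_tendstoD) (use a(1) in simp)
  then show False using lt by (auto simp: eventually_sequentially not_less[symmetric] dest: less_asym)
qed

text \<open>If the value 0 were attained at some \<open>p > 0\<close>, then by the intermediate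
  value theorem a small value would be attained on both sides of \<open>p\<close>, contradicting
  injectivity.\<close>

lemma homeomorphism_atLeast_0:
  fixes \<eta> :: "real \<Rightarrow> real"
  assumes "homeomorphism {0..} {0..} \<eta> \<eta>'"
  shows "0 \<le> t \<Longrightarrow> 0 \<le> \<eta> t" and "\<eta> 0 = 0" and "(\<eta> \<longlongrightarrow> 0) (at_right 0)"
proof -
  have cont: "continuous_on {0..} \<eta>" and img: "\<eta> ` {0..} = {0..}" and inv: "\<And>x. 0 \<le> x \<Longrightarrow> \<eta>' (\<eta> x) = x"
    using assms by (auto simp: homeomorphism_def)
  show nn: "0 \<le> \<eta> t" if "0 \<le> t" for t using img that by auto
  have inj: "x = y" if "\<eta> x = \<eta> y" "0 \<le> x" "0 \<le> y" for x y using inv that by metis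
  show "\<eta> 0 = 0"
  proof (rule ccontr)
    assume neq: "\<eta> 0 \<noteq> 0"
    have "0 \<in> \<eta> ` {0..}" using img by simp
    then obtain p where p: "0 \<le> p" "\<eta> p = 0" by force
    define c where "c = min (\<eta> 0) (\<eta> (p + 1))"
    have "\<eta> (p + 1) \<noteq> 0" using inj[of "p + 1" p] p by auto
    then have c: "0 < c" using neq nn[of 0] nn[of "p + 1"] p by (simp add: c_def)
    obtain x where x: "0 \<le> x" "x \<le> p" "\<eta> x = c"
      using IVT2'[of \<eta> p c 0] p c continuous_on_subset[OF cont] by (auto simp: c_def)
    obtain y where y: "p \<le> y" "y \<le> p + 1" "\<eta> y = c"
      using IVT'[of \<eta> p c "p + 1"] p c continuous_on_subset[OF cont] by (auto simp: c_def)
    have "x = y" using inj[of x y] x y p by simp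
    then have "x = p" using x y by simp
    then show False using x p c by simp
  qed
  then show "(\<eta> \<longlongrightarrow> 0) (at_right 0)"
    using cont unfolding continuous_on_def at_within_Ici_at_right[symmetric] by force
qed

section \<open>Flat cylinders over a full fibre\<close>

text \<open>\<open>J\<close> stands for the letters of a full fibre in direction \<open>i\<close>,
  and \<open>H\<close> for an invariant slice of the sponge on which the coordinates below
  \<open>i\<close> are constant. The number \<open>q\<close> bounds uniformly how much stronger the
  contraction is beyond \<open>i\<close> than in direction \<open>i\<close>.\<close>

locale graph_ifs =
  fixes T b :: "'k \<Rightarrow> real ^ 'n::{finite,linorder}" and J :: "'k set" and H :: "(real ^ 'n::{finite,linorder}) set"
    and i :: "'n::{finite,linorder}" and t\<^sub>0 t\<^sub>1 q :: real
  assumes t0: "0 < t\<^sub>0" and t1: "t\<^sub>1 < 1" and lam: "0 < q" "q < 1"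
    and T_pos: "\<And>k j. k \<in> J \<Longrightarrow> 0 < T k $ j"
    and T_bounds: "\<And>k. k \<in> J \<Longrightarrow> t\<^sub>0 \<le> T k $ i \<and> T k $ i \<le> t\<^sub>1"
    and T_lam: "\<And>k j. k \<in> J \<Longrightarrow> i < j \<Longrightarrow> T k $ j \<le> q * T k $ i"
    and compact_H: "compact H" and cube_H: "\<And>x j. x \<in> H \<Longrightarrow> 0 \<le> x $ j \<and> x $ j \<le> 1"
    and H_inv: "\<And>k. k \<in> J \<Longrightarrow> diag_map (T k) (b k) ` H \<subseteq> H"
    and H_eq: "\<And>x y j. x \<in> H \<Longrightarrow> y \<in> H \<Longrightarrow> j < i \<Longrightarrow> x $ j = y $ j"
    and H_onto: "\<And>u. 0 \<le> u \<Longrightarrow> u \<le> 1 \<Longrightarrow> \<exists>h\<in>H. h $ i = u"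
    and J_cover: "\<And>u. 0 \<le> u \<Longrightarrow> u \<le> 1 \<Longrightarrow> \<exists>k\<in>J. b k $ i \<le> u \<and> u \<le> b k $ i + T k $ i"
begin

text \<open>The number \<open>\<epsilon>\<close> measures flatness: the thickness beyond
  \<open>i\<close> relative to the height in direction \<open>i\<close>. Below \<open>i\<close> the
  set \<open>H\<close> has no extent, so positivity suffices there.\<close>

definition good :: "real \<Rightarrow> (real, 'n) vec \<Rightarrow> (real, 'n) vec \<Rightarrow> bool" where
  "good \<epsilon> v c \<longleftrightarrow> (\<forall>j. 0 < v $ j) \<and> (\<forall>j>i. v $ j \<le> \<epsilon> * v $ i) \<and> diag_map v c ` H \<subseteq> H"

definition refine_scale :: "(real, 'n) vec \<Rightarrow> 'k \<Rightarrow> (real, 'n) vec" where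
  "refine_scale v k = (\<chi> j. v $ j * T k $ j)"

definition refine_shift :: "(real, 'n) vec \<Rightarrow> (real, 'n) vec \<Rightarrow> 'k \<Rightarrow> (real, 'n) vec" where
  "refine_shift v c k = (\<chi> j. v $ j * b k $ j + c $ j)"

lemma diag_map_refine:
  "diag_map (refine_scale v k) (refine_shift v c k) x = diag_map v c (diag_map (T k) (b k) x)"
  by (simp add: diag_map_def refine_scale_def refine_shift_def vec_eq_iff algebra_simps)

lemma refine_subset:
  "k \<in> J \<Longrightarrow> diag_map (refine_scale v k) (refine_shift v c k) ` H \<subseteq> diag_map v c ` H"
  using H_inv by (force simp: diag_map_refine)

text \<open>A further letter gains a factor \<open>q\<close> of flatness, by \<open>T_lam\<close>.
  The weaker first conclusion keeps \<open>\<epsilon>\<close> fixed for repeated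
  subdivision.\<close>

lemma good_refine:
  assumes "good \<epsilon> v c" "k \<in> J" "0 \<le> \<epsilon>"
  shows "good \<epsilon> (refine_scale v k) (refine_shift v c k)"
    and "good (\<epsilon> * q) (refine_scale v k) (refine_shift v c k)"
proof -
  have v: "0 < v $ j" "j > i \<Longrightarrow> v $ j \<le> \<epsilon> * v $ i" for j using assms(1) by (auto simp: good_def)
  have le: "v $ j * T k $ j \<le> (\<epsilon> * v $ i) * (q * T k $ i)" if "j > i" for j
    using v T_pos T_lam assms that by (intro mult_mono) (auto simp: less_imp_le)
  have "(\<epsilon> * v $ i) * (q * T k $ i) \<le> (\<epsilon> * v $ i) * (1 * T k $ i)"
    using v[of i] T_pos[of k i] assms lam by (intro mult_left_mono mult_right_mono) (auto simp: less_imp_le)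
  with le have le': "v $ j * T k $ j \<le> (\<epsilon> * v $ i) * T k $ i" if "j > i" for j
    using that by fastforce
  show "good \<epsilon> (refine_scale v k) (refine_shift v c k)"
    "good (\<epsilon> * q) (refine_scale v k) (refine_shift v c k)"
    using refine_subset[of k v c] assms v T_pos le le' unfolding good_def
    by (auto simp: refine_scale_def mult_ac)
qed

lemma ex_good: "\<exists>v c. good (q ^ n) v c"
proof (induction n)
  case 0
  have "diag_map (\<chi> j. 1) 0 x = x" for x :: "(real, 'n) vec" by (simp add: diag_map_def vec_eq_iff)
  then have "good (q ^ 0) (\<chi> j. 1) 0" by (auto simp: good_def)
  then show ?case by blast
next
  case (Suc n)
  then obtain v c where "good (q ^ n) v c" by blast
  moreover obtain k where "k \<in> J" using J_cover[of 0] by auto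
  ultimately have "good (q ^ n * q) (refine_scale v k) (refine_shift v c k)"
    using lam by (intro good_refine) auto
  then show ?case by (auto simp: mult.commute)
qed

text \<open>Follow the covering intervals of \<open>J\<close> around the given height and stop once
  the size is at most \<open>r\<close>. Each letter shrinks it by a factor of at least
  \<open>t\<^sub>0\<close>, so it does not fall below \<open>t\<^sub>0 * r\<close>.\<close>

lemma ex_piece:
  assumes "good \<epsilon> v c" "0 \<le> \<epsilon>" "0 \<le> u" "u \<le> 1" "0 < r" "t\<^sub>0 * r \<le> v $ i"
  shows "\<exists>v' c'. good \<epsilon> v' c' \<and> diag_map v' c' ` H \<subseteq> diag_map v c ` H \<and> t\<^sub>0 * r \<le> v' $ i \<and> v' $ i \<le> r \<and>
    c' $ i \<le> v $ i * u + c $ i \<and> v $ i * u + c $ i \<le> c' $ i + v' $ i"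
proof -
  have "(\<lambda>n. v $ i * t\<^sub>1 ^ n) \<longlonglongrightarrow> 0"
  proof (intro tendsto_mult_right_zero LIMSEQ_realpow_zero)
    obtain k where "k \<in> J" using J_cover[of 0] by auto
    then show "0 \<le> t\<^sub>1" using T_bounds[of k] t0 by simp
  qed (rule t1)
  then have "\<exists>n. v $ i * t\<^sub>1 ^ n < r" 
    using order_tendstoD(2)[OF _ assms(5)] eventually_happens[of _ sequentially] by fastforce
  then obtain n where "v $ i * t\<^sub>1 ^ n \<le> r" using less_imp_le by blast
  then show ?thesis using assms
  proof (induction n arbitrary: v c u)
    case 0
    then show ?case by (intro exI[of _ v] exI[of _ c]) (auto simp: good_def less_imp_le mult_left_le)
  next
    case (Suc n)
    show ?case
    proof (cases "v $ i \<le> r")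
      case True
      then show ?thesis using Suc.prems
        by (intro exI[of _ v] exI[of _ c]) (auto simp: good_def less_imp_le mult_left_le)
    next
      case False
      obtain k where k: "k \<in> J" "b k $ i \<le> u" "u \<le> b k $ i + T k $ i" using J_cover Suc.prems by blast
      note Tk = T_pos[OF k(1), of i] T_bounds[OF k(1)]
      \<comment> \<open>The same height, expressed in the coordinate of the refined
        cylinder.\<close>
      define u' where "u' = (u - b k $ i) / T k $ i"
      let ?v = "refine_scale v k" and ?c = "refine_shift v c k"
      have vi: "0 < v $ i" using Suc.prems(2) by (simp add: good_def)
      have t1n: "0 \<le> t\<^sub>1 ^ n" using Tk t0 by simp
      have "?v $ i * t\<^sub>1 ^ n \<le> v $ i * t\<^sub>1 ^ Suc n"
        using vi t1n Tk by (simp add: refine_scale_def mult.assoc mult_right_mono)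
      then have 1: "?v $ i * t\<^sub>1 ^ n \<le> r" using Suc.prems(1) by linarith
      have 2: "0 \<le> u'" "u' \<le> 1" using k Tk by (auto simp: u'_def)
      have "t\<^sub>0 * r \<le> T k $ i * v $ i" using False Tk t0 vi Suc.prems by (intro mult_mono) auto
      then have 3: "t\<^sub>0 * r \<le> ?v $ i" by (simp add: refine_scale_def mult.commute)
      have 4: "?v $ i * u' + ?c $ i = v $ i * u + c $ i"
        using Tk by (simp add: refine_scale_def refine_shift_def u'_def field_simps)
      show ?thesis
        using Suc.IH[OF 1 good_refine(1)[OF Suc.prems(2) k(1) Suc.prems(3)] Suc.prems(3) 2 Suc.prems(6) 3]
          refine_subset[OF k(1), of v c] unfolding 4 by (meson order_trans)
    qed
  qed
qed

text \<open>Below \<open>i\<close> the coordinates agree and beyond \<open>i\<close> they differ by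
  at most the thickness; so a flat cylinder looks like a segment in direction
  \<open>i\<close>.\<close>

lemma dist_piece_le:
  assumes g: "good \<epsilon> v c" and xy: "x \<in> diag_map v c ` H" "y \<in> diag_map v c ` H" and \<epsilon>: "0 \<le> \<epsilon>"
  shows "dist x y \<le> \<bar>x $ i - y $ i\<bar> + v $ i * (real CARD('n) * \<epsilon>)"
proof -
  obtain h h' where h: "h \<in> H" "h' \<in> H" "x = diag_map v c h" "y = diag_map v c h'" using xy by blast
  have vi: "0 < v $ j" for j using g by (simp add: good_def)
  have xyj: "x $ j - y $ j = v $ j * (h $ j - h' $ j)" for j by (simp add: h diag_map_def algebra_simps)
  have "dist x y \<le> (\<Sum>j\<in>UNIV. \<bar>x $ j - y $ j\<bar>)"
    using norm_le_l1_cart[of "x - y"] by (simp add: dist_norm)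
  also have "\<dots> \<le> (\<Sum>j\<in>UNIV. (if j = i then \<bar>x $ i - y $ i\<bar> else 0) + \<epsilon> * v $ i)"
  proof (rule sum_mono)
    fix j
    have nn: "0 \<le> \<epsilon> * v $ i" using \<epsilon> vi[of i] by simp
    consider "j < i" | "j = i" | "i < j" by force
    then show "\<bar>x $ j - y $ j\<bar> \<le> (if j = i then \<bar>x $ i - y $ i\<bar> else 0) + \<epsilon> * v $ i"
    proof cases
      case 1
      then show ?thesis using H_eq[OF h(1,2) 1] nn by (simp add: xyj)
    next
      case 2
      then show ?thesis using nn by simp
    next
      case 3
      have "\<bar>x $ j - y $ j\<bar> = v $ j * \<bar>h $ j - h' $ j\<bar>" using vi[of j] by (simp add: xyj abs_mult)
      also have "\<dots> \<le> v $ j * 1" using cube_H[OF h(1), of j] cube_H[OF h(2), of j] vi[of j]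
        by (intro mult_left_mono) auto
      also have "\<dots> \<le> \<epsilon> * v $ i" using g 3 by (simp add: good_def)
      finally show ?thesis using 3 by simp
    qed
  qed
  also have "\<dots> = \<bar>x $ i - y $ i\<bar> + v $ i * (real CARD('n) * \<epsilon>)"
    by (simp add: sum.distrib)
  finally show ?thesis .
qed

lemma piece_bounds:
  assumes "good \<epsilon> v c" "x \<in> diag_map v c ` H"
  shows "c $ i \<le> x $ i" "x $ i \<le> c $ i + v $ i"
  using assms cube_H[of _ i] by (auto simp: diag_map_def good_def mult_left_le less_imp_le)

definition point :: "(real, 'n) vec \<Rightarrow> (real, 'n) vec \<Rightarrow> real \<Rightarrow> (real, 'n) vec" where
  "point v c u = diag_map v c (SOME h. h \<in> H \<and> h $ i = u)"

lemma point:
  assumes "0 \<le> u" "u \<le> 1"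
  shows "point v c u \<in> diag_map v c ` H" "point v c u $ i = v $ i * u + c $ i"
proof -
  have "\<exists>h. h \<in> H \<and> h $ i = u" using H_onto assms by blast
  from someI_ex[OF this] show "point v c u \<in> diag_map v c ` H" "point v c u $ i = v $ i * u + c $ i"
    by (auto simp: point_def diag_map_def)
qed

end

section \<open>Quasisymmetric distortion of flat cylinders\<close>

text \<open>The metric \<open>\<rho>\<close> is the target metric pulled back to \<open>X\<close>.
  The distortion bound is stated without quotients.\<close>

locale qs_graph_ifs = graph_ifs T b J H i t\<^sub>0 t\<^sub>1 q
  for T b :: "'k \<Rightarrow> real ^ 'n::{finite,linorder}" and J H i t\<^sub>0 t\<^sub>1 q +
  fixes X :: "(real ^ 'n::{finite,linorder}) set" and \<rho> :: "real ^ 'n::{finite,linorder} \<Rightarrow> real ^ 'n::{finite,linorder} \<Rightarrow> real"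
    and \<eta> :: "real \<Rightarrow> real"
  assumes HX: "H \<subseteq> X" and metric: "Metric_space X \<rho>"
    and qs: "\<And>x y z t. x \<in> X \<Longrightarrow> y \<in> X \<Longrightarrow> z \<in> X \<Longrightarrow> x \<noteq> y \<Longrightarrow> y \<noteq> z \<Longrightarrow> x \<noteq> z \<Longrightarrow> 0 < t \<Longrightarrow>
      dist x y \<le> t * dist y z \<Longrightarrow> \<rho> x y \<le> \<eta> t * \<rho> y z"
    and eta_nonneg: "\<And>t. 0 \<le> t \<Longrightarrow> 0 \<le> \<eta> t"
    and eta_lim: "(\<eta> \<longlongrightarrow> 0) (at_right 0)"
begin

sublocale \<rho>: Metric_space X \<rho> by (rule metric)

text \<open>Quasisymmetry only speaks of distinct triples; the maximum with 1 covers
  \<open>x = z\<close>.\<close>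

lemma qs_le:
  assumes "x \<in> X" "y \<in> X" "z \<in> X" "y \<noteq> z" "0 < t" "dist x y \<le> t * dist y z"
  shows "\<rho> x y \<le> max 1 (\<eta> t) * \<rho> y z"
proof (cases "x = y \<or> x = z")
  case True
  have "1 * \<rho> y z \<le> max 1 (\<eta> t) * \<rho> y z" by (intro mult_right_mono) auto
  then show ?thesis using True assms(1,2) by (auto simp: \<rho>.commute intro: order_trans[OF \<rho>.nonneg])
next
  case False
  have "\<eta> t * \<rho> y z \<le> max 1 (\<eta> t) * \<rho> y z" by (intro mult_right_mono) auto
  then show ?thesis using qs[OF assms(1-3) _ assms(4) _ assms(5,6)] False by linarith
qed

text \<open>For \<open>t < 1\<close> the case \<open>x = z\<close> is impossible, so the factor
  \<open>\<eta> t\<close> remains and can be made small.\<close>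

lemma qs_le_small:
  assumes "x \<in> X" "y \<in> X" "z \<in> X" "y \<noteq> z" "0 < t" "t < 1" "dist x y \<le> t * dist y z"
  shows "\<rho> x y \<le> \<eta> t * \<rho> y z"
proof (cases "x = y")
  case True
  then show ?thesis using assms(1,5) eta_nonneg by simp
next
  case False
  have "t * dist y z < dist y z" using assms(4,6) by simp
  then have "x \<noteq> z" using assms(7) by (auto simp: dist_commute)
  then show ?thesis using qs[OF assms(1-3) False assms(4) _ assms(5,7)] by simp
qed

text \<open>The distance of the images of a bottom and a top point serves as the size of the
  distorted cylinder.\<close>

definition D :: "(real, 'n) vec \<times> (real, 'n) vec \<Rightarrow> real" where
  "D w = \<rho> (point (fst w) (snd w) 0) (point (fst w) (snd w) 1)"

lemma good_subset: "good \<epsilon> v c \<Longrightarrow> diag_map v c ` H \<subseteq> X"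
  using HX by (auto simp: good_def)

lemma D_pos: 
  assumes "good \<epsilon> v c"
  shows "0 < D (v, c)"
proof -
  have "point v c 0 $ i \<noteq> point v c 1 $ i" using assms by (simp add: point good_def less_imp_neq[symmetric])
  then show ?thesis using point(1)[of 0 v c] point(1)[of 1 v c] good_subset[OF assms]
    by (auto simp: D_def \<rho>.mdist_pos_eq subset_iff)
qed

text \<open>Points \<open>P p\<close> at equally spaced heights carry pieces whose size is
  comparable to the spacing. Neighbouring points are joined through a piece at a cost bounded by its
  size, with a constant \<open>A\<close> free of \<open>m\<close>. Smallness and separation of the
  pieces pass to \<open>\<rho>\<close> by quasisymmetry.\<close>

lemma subdivide:
  fixes m :: nat
  defines "A \<equiv> max 1 (\<eta> (12 / t\<^sub>0))" and "B \<equiv> max 1 (\<eta> 2)" and "G \<equiv> max 1 (\<eta> (4 * real m))"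
  assumes g: "good \<epsilon> v c" and m: "2 \<le> m" and \<epsilon>: "0 \<le> \<epsilon>" "real CARD('n) * \<epsilon> \<le> 1 / real m"
  shows "\<exists>w'. (\<forall>p<m. good \<epsilon> (fst (w' p)) (snd (w' p)) \<and>
        diag_map (fst (w' p)) (snd (w' p)) ` H \<subseteq> diag_map v c ` H \<and>
        D (w' p) \<le> \<eta> (1 / real m) * B * D (v, c)) \<and>
      D (v, c) \<le> 2 * A * (\<Sum>p<m. D (w' p)) \<and>
      (\<forall>p<m. \<forall>p'<m. \<forall>x\<in>diag_map (fst (w' p)) (snd (w' p)) ` H. \<forall>y\<in>diag_map (fst (w' p')) (snd (w' p')) ` H.
        p \<noteq> p' \<longrightarrow> D (v, c) \<le> 2 * G * \<rho> x y)"
proof -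
  define t where "t = v $ i"
  have t: "0 < t" using g by (simp add: t_def good_def)
  have m0: "0 < real m" using m by simp
  define P where "P p = point v c (real p / real m)" for p :: nat
  have P: "P p \<in> diag_map v c ` H" "P p $ i = t * (real p / real m) + c $ i" if "p \<le> m" for p
    using point[of "real p / real m" v c] that m0 by (auto simp: P_def t_def)
  have sub: "diag_map v c ` H \<subseteq> X" using g by (rule good_subset)
  have dist_le: "dist x y \<le> \<bar>x $ i - y $ i\<bar> + t / real m"
    if "x \<in> diag_map v c ` H" "y \<in> diag_map v c ` H" for x y
  proof -
    have "t * (real CARD('n) * \<epsilon>) \<le> t * (1 / real m)" using \<epsilon>(2) t by (intro mult_left_mono) auto
    then show ?thesis using dist_piece_le[OF g that \<epsilon>(1)] by (simp add: t_def)
  qed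
  have dist_ge: "\<bar>x $ i - y $ i\<bar> \<le> dist x y" for x y :: "(real, 'n) vec"
    using component_le_norm_cart[of "x - y" i] by (simp add: dist_norm)
  have D_eq: "D (v, c) = \<rho> (P 0) (P m)" using m0 by (simp add: D_def P_def)
  \<comment> \<open>A quarter of the spacing: pieces of height at most \<open>r\<close> at different
    \<open>P p\<close> stay at least \<open>2 * r\<close> apart.\<close>
  define r where "r = t / (4 * real m)"
  have r: "0 < r" "t / real m = 4 * r" using t m0 by (auto simp: r_def)
  have t0_le: "t\<^sub>0 \<le> 1" using J_cover[of 0] T_bounds t1 by fastforce
  have "r \<le> t" using t m by (simp add: r_def field_simps) 
  then have "t\<^sub>0 * r \<le> t" using mult_right_mono[OF t0_le, of r] r by linarith
  then have "\<exists>w. good \<epsilon> (fst w) (snd w) \<and> diag_map (fst w) (snd w) ` H \<subseteq> diag_map v c ` H \<and>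
      t\<^sub>0 * r \<le> fst w $ i \<and> fst w $ i \<le> r \<and> snd w $ i \<le> P p $ i \<and> P p $ i \<le> snd w $ i + fst w $ i" if "p \<le> m" for p
    using ex_piece[OF g \<epsilon>(1), of "real p / real m" r] r m0 that by (simp add: P t_def) 
  then obtain w' where w': "\<And>p. p \<le> m \<Longrightarrow> good \<epsilon> (fst (w' p)) (snd (w' p)) \<and>
      diag_map (fst (w' p)) (snd (w' p)) ` H \<subseteq> diag_map v c ` H \<and>
      t\<^sub>0 * r \<le> fst (w' p) $ i \<and> fst (w' p) $ i \<le> r \<and> snd (w' p) $ i \<le> P p $ i \<and> P p $ i \<le> snd (w' p) $ i + fst (w' p) $ i"
    by metis
  define S where "S p = diag_map (fst (w' p)) (snd (w' p)) ` H" for p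
  have S_sub: "S p \<subseteq> diag_map v c ` H" if "p \<le> m" for p using w'[OF that] by (simp add: S_def)
  have S_near: "\<bar>x $ i - P p $ i\<bar> \<le> r" if "x \<in> S p" "p \<le> m" for x p
    using piece_bounds[of \<epsilon> "fst (w' p)" "snd (w' p)" x] w'[OF that(2)] that(1) unfolding S_def by linarith
  define l where "l p = point (fst (w' p)) (snd (w' p)) 0" for p
  define u where "u p = point (fst (w' p)) (snd (w' p)) 1" for p
  have lu: "l p \<in> S p" "u p \<in> S p" "u p $ i - l p $ i = fst (w' p) $ i" for p
    by (auto simp: l_def u_def S_def point)
  have D'_eq: "D (w' p) = \<rho> (l p) (u p)" for p by (simp add: D_def l_def u_def)
  have lu_dist: "t\<^sub>0 * r \<le> dist (l p) (u p)" if "p \<le> m" for p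
    using dist_ge[of "l p" "u p"] lu(3)[of p] w'[OF that] by linarith
  have lu_neq: "l p \<noteq> u p" if "p \<le> m" for p using lu_dist[OF that] mult_pos_pos[OF t0 r(1)] by auto
  have inX: "l p \<in> X" "u p \<in> X" "P p \<in> X" if "p \<le> m" for p
    using lu S_sub[OF that] P[OF that] sub by blast+
  have P_step: "\<rho> (P p) (P (Suc p)) \<le> 2 * A * D (w' p)" if p: "p < m" for p
  proof -
    \<comment> \<open>The heights differ by at most \<open>4 * r + r\<close> and the thickness adds
      \<open>4 * r\<close>, well below \<open>12 * r\<close>; the piece has length at least
      \<open>t\<^sub>0 * r\<close>.\<close>
    have near: "\<rho> (P p') (l p) \<le> A * \<rho> (l p) (u p)" if p': "p' = p \<or> p' = Suc p" for p'
      unfolding A_def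
    proof (rule qs_le)
      have p'm: "p' \<le> m" using p p' by auto
      have "dist (P p') (l p) \<le> \<bar>P p' $ i - l p $ i\<bar> + 4 * r"
        using dist_le[OF P(1)[OF p'm] subsetD[OF S_sub lu(1)], of p] p r(2) by simp
      moreover have "\<bar>P p' $ i - P p $ i\<bar> \<le> 4 * r"
        using p' P[of p'] P[of p] p r by (auto simp: add_divide_distrib distrib_left)
      moreover have "\<bar>l p $ i - P p $ i\<bar> \<le> r" using S_near[of "l p" p] lu p by simp
      ultimately have "dist (P p') (l p) \<le> 12 * r" using r(1) by linarith
      also have "\<dots> = 12 / t\<^sub>0 * (t\<^sub>0 * r)" using t0 by simp
      also have "\<dots> \<le> 12 / t\<^sub>0 * dist (l p) (u p)" using lu_dist[of p] p t0 by (intro mult_left_mono) auto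
      finally show "dist (P p') (l p) \<le> 12 / t\<^sub>0 * dist (l p) (u p)" .
      show "P p' \<in> X" "l p \<in> X" "u p \<in> X" "l p \<noteq> u p" "0 < 12 / t\<^sub>0"
        using inX[of p] inX[OF p'm] lu_neq[of p] p t0 by auto
    qed
    have "\<rho> (P p) (P (Suc p)) \<le> \<rho> (P p) (l p) + \<rho> (P (Suc p)) (l p)"
      using \<rho>.triangle[of "P p" "l p" "P (Suc p)"] inX[of p] inX[of "Suc p"] p by (simp add: \<rho>.commute)
    also have "\<dots> \<le> 2 * A * D (w' p)" using near[of p] near[of "Suc p"] by (simp add: D'_eq)
    finally show ?thesis .
  qed
  have chain: "\<rho> (P 0) (P k) \<le> (\<Sum>p<k. \<rho> (P p) (P (Suc p)))" if "k \<le> m" for k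
    using that
  proof (induction k)
    case (Suc k)
    then show ?case using \<rho>.triangle[of "P 0" "P k" "P (Suc k)"] inX[of 0] inX[of k] inX[of "Suc k"] by simp
  qed (simp add: inX)
  have D_le: "D (v, c) \<le> 2 * A * (\<Sum>p<m. D (w' p))"
    using order_trans[OF chain[OF order_refl] sum_mono[OF P_step]] by (simp add: D_eq sum_distrib_left)
  have ends: "P 0 \<in> diag_map v c ` H" "P m \<in> diag_map v c ` H" "P m $ i - P 0 $ i = t"
    using P[of 0] P[of m] m0 by auto
  have t_le: "t \<le> dist (P 0) (P m)" using dist_ge[of "P m" "P 0"] ends(3) by (simp add: dist_commute)
  have m_le: "t / real m \<le> t / 2" using t m by (intro divide_left_mono) auto
  have near_end: "dist x z \<le> 2 * t" if "x \<in> diag_map v c ` H" "z \<in> diag_map v c ` H" for x z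
    using dist_le[OF that] piece_bounds[OF g that(1)] piece_bounds[OF g that(2)] m_le t
    unfolding t_def[symmetric] by linarith
  have D'_le: "D (w' p) \<le> \<eta> (1 / real m) * B * D (v, c)" if p: "p < m" for p
  proof -
    have lS: "l p \<in> diag_map v c ` H" using lu S_sub[of p] p by auto
    \<comment> \<open>One of the two ends is at height distance at least \<open>t / 2\<close> from
      \<open>l p\<close>; \<open>z\<close> is that end and \<open>z'\<close> the other.\<close>
    obtain z z' where z: "z = P 0 \<and> z' = P m \<or> z = P m \<and> z' = P 0" and far: "t / 2 \<le> \<bar>l p $ i - z $ i\<bar>"
    proof (cases "t / 2 \<le> \<bar>l p $ i - P 0 $ i\<bar>")
      case False
      then have "t / 2 \<le> \<bar>l p $ i - P m $ i\<bar>" using ends(3) by linarith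
      then show ?thesis using that by blast
    qed (use that in blast)
    have zX: "z \<in> X" "z' \<in> X" "z \<in> diag_map v c ` H" using z ends sub by auto
    have far': "t / 2 \<le> dist (l p) z" using far dist_ge[of "l p" z] by linarith
    \<comment> \<open>Height \<open>r\<close> plus thickness at most \<open>r\<close> gives
      \<open>2 * r\<close>, which is \<open>1 / m\<close> times \<open>t / 2\<close>.\<close>
    have "dist (u p) (l p) \<le> \<bar>u p $ i - l p $ i\<bar> + fst (w' p) $ i * (real CARD('n) * \<epsilon>)"
      by (rule dist_piece_le[of \<epsilon> "fst (w' p)" "snd (w' p)"]) (use w'[of p] p lu \<epsilon> in \<open>auto simp: S_def\<close>)
    also have "\<dots> \<le> r + r * 1"
    proof (intro add_mono mult_mono)
      show "real CARD('n) * \<epsilon> \<le> 1" using \<epsilon>(2) m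
        by (rule_tac order_trans[of _ "1 / real m"]) auto
      show "\<bar>u p $ i - l p $ i\<bar> \<le> r" "fst (w' p) $ i \<le> r"
        using lu(3)[of p] w'[of p] p r t0 by (auto simp: good_def abs_of_pos)
    qed (use r \<epsilon> in auto)
    also have "\<dots> = 1 / real m * (t / 2)" using m0 by (simp add: r_def)
    also have "\<dots> \<le> 1 / real m * dist (l p) z" using far' m0 by (intro mult_left_mono) auto
    finally have small: "dist (u p) (l p) \<le> 1 / real m * dist (l p) z" .
    have "l p \<noteq> z" using far' t by auto
    then have "\<rho> (u p) (l p) \<le> \<eta> (1 / real m) * \<rho> (l p) z"
      using inX[of p] p zX small m by (intro qs_le_small) auto
    also have "\<dots> \<le> \<eta> (1 / real m) * (B * \<rho> z z')"
    proof (rule mult_left_mono)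
      have zz': "t \<le> dist z z'" using z t_le by (auto simp: dist_commute)
      show "\<rho> (l p) z \<le> B * \<rho> z z'" unfolding B_def
        by (rule qs_le) (use inX[of p] p zX zz' t near_end[OF lS zX(3)] in auto)
    qed (use eta_nonneg m0 in simp)
    also have "\<rho> z z' = D (v, c)" using z D_eq by (auto simp: \<rho>.commute)
    finally show ?thesis by (simp add: D'_eq \<rho>.commute mult.assoc)
  qed
  have sep: "D (v, c) \<le> 2 * G * \<rho> x y" if pp: "p < m" "p' < m" "p \<noteq> p'" and xy: "x \<in> S p" "y \<in> S p'" for p p' x y
  proof -
    have xyP: "x \<in> diag_map v c ` H" "y \<in> diag_map v c ` H" using xy S_sub[of p] S_sub[of p'] pp by auto
    have "P p $ i - P p' $ i = t / real m * (real p - real p')"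
      using P[of p] P[of p'] pp by (simp add: right_diff_distrib)
    then have "P p $ i - P p' $ i = 4 * r * (real p - real p')" by (simp only: r(2))
    moreover have "1 \<le> \<bar>real p - real p'\<bar>" using pp(3) by linarith
    ultimately have "4 * r * 1 \<le> \<bar>P p $ i - P p' $ i\<bar>"
      using r(1) by (simp only: abs_mult) (intro mult_mono; simp)
    then have far: "2 * r \<le> dist x y"
      using S_near[OF xy(1)] S_near[OF xy(2)] pp dist_ge[of x y] by linarith
    then have "x \<noteq> y" using r(1) by auto
    have near: "\<rho> z x \<le> G * \<rho> x y" if "z \<in> diag_map v c ` H" for z unfolding G_def
    proof (rule qs_le)
      have "dist z x \<le> 2 * t" by (rule near_end[OF that xyP(1)])
      also have "\<dots> = 4 * real m * (2 * r)" using m0 by (simp add: r_def)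
      also have "\<dots> \<le> 4 * real m * dist x y" using far by (intro mult_left_mono) auto
      finally show "dist z x \<le> 4 * real m * dist x y" .
    qed (use that xyP sub \<open>x \<noteq> y\<close> m0 in auto)
    have "D (v, c) \<le> \<rho> (P 0) x + \<rho> (P m) x"
      using \<rho>.triangle[of "P 0" x "P m"] inX[of 0] inX[of m] xyP sub unfolding D_eq by (auto simp: \<rho>.commute)
    also have "\<dots> \<le> 2 * G * \<rho> x y" using near[OF ends(1)] near[OF ends(2)] by simp
    finally show ?thesis .
  qed
  show ?thesis
    by (rule exI[of _ w']) (use w' D'_le D_le sep in \<open>auto simp: S_def\<close>)
qed

text \<open>Since all pieces are small relative to the cylinder, the linear bound of
  \<open>subdivide\<close> improves to the bound on sums of \<open>s\<close>-th powers needed by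
  \<open>no_cheap_cover\<close>; the loss \<open>2 * A\<close> is absorbed because
  \<open>s < 1\<close>.\<close>

lemma hausdorff_measure_neq_0:
  assumes s: "0 < s" "s < 1"
  shows "hausdorff_measure X \<rho> s \<noteq> 0"
proof -
  define A where "A = max 1 (\<eta> (12 / t\<^sub>0))"
  define B where "B = max 1 (\<eta> 2)"
  define e where "e = min (1 / 2) ((1 / (2 * A)) powr (1 / (1 - s)))"
  have AB: "1 \<le> A" "1 \<le> B" by (auto simp: A_def B_def)
  have e: "0 < e" "e \<le> 1 / 2" using AB by (auto simp: e_def)
  have e_pow: "2 * A * e powr (1 - s) \<le> 1"
  proof -
    have "e powr (1 - s) \<le> ((1 / (2 * A)) powr (1 / (1 - s))) powr (1 - s)"
      using s e by (intro powr_mono2) (auto simp: e_def)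
    also have "\<dots> = 1 / (2 * A)" using s AB by (simp add: powr_powr)
    finally show ?thesis using AB by (simp add: field_simps)
  qed
  \<comment> \<open>\<open>A\<close> and \<open>B\<close> do not depend on \<open>m\<close>, so
    \<open>m\<close> can be chosen after \<open>e\<close>. The flatness \<open>q ^ n\<close> comes
    last, in terms of \<open>m\<close>.\<close>
  have "(\<lambda>m. \<eta> (1 / real (Suc m))) \<longlonglongrightarrow> 0"
    by (rule filterlim_compose[OF eta_lim], rule tendsto_imp_filterlim_at_right)
      (use LIMSEQ_inverse_real_of_nat in \<open>auto simp: inverse_eq_divide\<close>)
  then have "eventually (\<lambda>m. \<eta> (1 / real (Suc m)) < e / B) sequentially"
    by (rule order_tendstoD) (use e AB in auto)
  then obtain m' where m': "\<eta> (1 / real (Suc m')) < e / B" "1 \<le> m'"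
    using eventually_happens[OF eventually_conj[OF _ eventually_ge_at_top[of "1::nat"]]] by auto
  define m where "m = Suc m'"
  have m: "2 \<le> m" "\<eta> (1 / real m) * B \<le> e" using m' AB by (auto simp: m_def field_simps)
  define G where "G = max 1 (\<eta> (4 * real m))"
  have "(\<lambda>n. real CARD('n) * q ^ n) \<longlonglongrightarrow> 0"
    by (intro tendsto_mult_right_zero LIMSEQ_realpow_zero) (use lam in auto)
  then have "eventually (\<lambda>n. real CARD('n) * q ^ n < 1 / real m) sequentially"
    by (rule order_tendstoD) (use m in auto)
  then obtain n where n: "real CARD('n) * q ^ n \<le> 1 / real m"
    by (auto simp: eventually_sequentially dest: less_imp_le)
  define P where "P w \<longleftrightarrow> good (q ^ n) (fst w) (snd w)" for w
  define S where "S w = diag_map (fst w) (snd w) ` H" for w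
  obtain w0 where w0: "P w0" using ex_good[of n] by (auto simp: P_def)
  have D_pos': "0 < D w" if "P w" for w using D_pos[of _ "fst w" "snd w"] that by (simp add: P_def)
  have step: "\<exists>w'. (\<forall>p<m. P (w' p) \<and> S (w' p) \<subseteq> S w \<and> D (w' p) \<le> D w / 2) \<and>
      D w powr s \<le> (\<Sum>p<m. D (w' p) powr s) \<and>
      (\<forall>p<m. \<forall>p'<m. \<forall>x\<in>S (w' p). \<forall>y\<in>S (w' p'). p \<noteq> p' \<longrightarrow> 1 / (2 * G) * D w \<le> \<rho> x y)" if w: "P w" for w
  proof -
    have qn: "0 \<le> q ^ n" using lam by simp
    obtain w' where w': "\<And>p. p < m \<Longrightarrow> P (w' p) \<and> S (w' p) \<subseteq> S w \<and> D (w' p) \<le> \<eta> (1 / real m) * B * D w"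
      and D_le: "D w \<le> 2 * A * (\<Sum>p<m. D (w' p))"
      and sep: "\<And>p p' x y. p < m \<Longrightarrow> p' < m \<Longrightarrow> x \<in> S (w' p) \<Longrightarrow> y \<in> S (w' p') \<Longrightarrow> p \<noteq> p' \<Longrightarrow>
        D w \<le> 2 * G * \<rho> x y"
      using subdivide[OF w[unfolded P_def] m(1) qn n, folded A_def B_def G_def P_def S_def]
      unfolding prod.collapse by metis
    have De: "D (w' p) \<le> e * D w" if "p < m" for p
      using w'[OF that] mult_right_mono[OF m(2), of "D w"] D_pos'[OF w] by linarith
    have "D (w' p) \<le> D w / 2" if "p < m" for p
      using De[OF that] mult_right_mono[OF e(2), of "D w"] D_pos'[OF w] by linarith
    moreover have "D w powr s \<le> (\<Sum>p<m. D (w' p) powr s)"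
    proof -
      \<comment> \<open>Split off the power \<open>1 - s\<close> of the size and estimate it by
        \<open>e * D w\<close>; this yields the factor that beats \<open>2 * A\<close>.\<close>
      have 1: "D (w' p) \<le> e powr (1 - s) * D w powr (1 - s) * D (w' p) powr s" if "p < m" for p
      proof -
        have pos: "0 < D (w' p)" using D_pos' w'[OF that] by blast
        have "D (w' p) = D (w' p) powr (1 - s) * D (w' p) powr s" using pos by (simp flip: powr_add)
        also have "\<dots> \<le> (e * D w) powr (1 - s) * D (w' p) powr s"
          using De[OF that] pos s by (intro mult_right_mono powr_mono2) auto
        finally show ?thesis using e D_pos'[OF w] by (simp add: powr_mult)
      qed
      have "D w \<le> 2 * A * (\<Sum>p<m. e powr (1 - s) * D w powr (1 - s) * D (w' p) powr s)"
        using AB by (intro order_trans[OF D_le] mult_left_mono sum_mono 1) auto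
      also have "\<dots> = (2 * A * e powr (1 - s)) * (D w powr (1 - s) * (\<Sum>p<m. D (w' p) powr s))"
        by (simp add: sum_distrib_left mult_ac)
      also have "\<dots> \<le> 1 * (D w powr (1 - s) * (\<Sum>p<m. D (w' p) powr s))"
        by (intro mult_right_mono e_pow mult_nonneg_nonneg sum_nonneg) auto
      finally have "D w powr (1 - s) * D w powr s \<le> D w powr (1 - s) * (\<Sum>p<m. D (w' p) powr s)"
        using D_pos'[OF w] by (simp flip: powr_add)
      then show ?thesis using D_pos'[OF w] by simp
    qed
    moreover have "1 / (2 * G) * D w \<le> \<rho> x y"
      if "p < m" "p' < m" "x \<in> S (w' p)" "y \<in> S (w' p')" "p \<noteq> p'" for p p' x y
      using sep[OF that] by (simp add: G_def field_simps)
    ultimately show ?thesis using w' by (intro exI[of _ w']) blast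
  qed
  have SP: "compact (S w) \<and> S w \<noteq> {}" if "P w" for w
  proof
    have "continuous_on H (diag_map (fst w) (snd w))"
      unfolding diag_map_def by (intro continuous_intros)
    then show "compact (S w)" unfolding S_def using compact_H by (rule compact_continuous_image)
    show "S w \<noteq> {}" using H_onto[of 0] by (auto simp: S_def)
  qed
  have G: "0 < 1 / (2 * G)" by (simp add: G_def)
  show ?thesis
  proof (rule hausdorff_measure_neq_0I[OF s(1), where c = "(1 / (2 * G) * D w0) powr s"])
    show "0 < (1 / (2 * G) * D w0) powr s" using G D_pos'[OF w0] by simp
    fix U :: "nat \<Rightarrow> _ set" and a :: "nat \<Rightarrow> real"
    assume *: "X \<subseteq> (\<Union>n. U n)" "\<And>n. 0 < a n" "summable a"
      "\<And>n x y. x \<in> U n \<Longrightarrow> y \<in> U n \<Longrightarrow> \<rho> x y powr s \<le> a n"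
    have cov: "S w0 \<subseteq> (\<Union>n. U n)"
      using *(1) good_subset[OF w0[unfolded P_def]] unfolding S_def by (rule order_trans[rotated])
    show "(1 / (2 * G) * D w0) powr s \<le> suminf a"
      by (rule no_cheap_cover[OF s(1) G, of P w0 S D m \<rho> U a]) (use w0 SP D_pos' step cov *(2-4) in auto)
  qed (rule \<rho>.nonneg)
qed

end

section \<open>Lalley-Gatzouras sponges\<close>

locale sponge =
  fixes N :: nat and T b :: "nat \<Rightarrow> real ^ 'n::{finite,linorder}" and K :: "(real ^ 'n::{finite,linorder}) set"
  assumes sponge: "lalley_gatzouras_sponge N T b K"
begin

lemma T_pos: "k \<in> {1..N} \<Longrightarrow> 0 < T k $ j"
  and T_less_1: "k \<in> {1..N} \<Longrightarrow> T k $ j < 1"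
  and T_order: "k \<in> {1..N} \<Longrightarrow> j < j' \<Longrightarrow> T k $ j' < T k $ j"
  and compact_K: "compact K" and K_nonempty: "K \<noteq> {}"
  and K_eq: "K = (\<Union>k\<in>{1..N}. diag_map (T k) (b k) ` K)"
  and K_cube: "x \<in> K \<Longrightarrow> 0 \<le> x $ j \<and> x $ j \<le> 1"
  and neat: "neat_projection N T b"
  using sponge unfolding lalley_gatzouras_sponge_def diagonal_ifs_def coordinate_ordering_def is_attractor_def
  by blast+

lemma K_inv: "k \<in> {1..N} \<Longrightarrow> x \<in> K \<Longrightarrow> diag_map (T k) (b k) x \<in> K"
  using K_eq by blast

lemma N_nonempty: "{1..N} \<noteq> {}"
  using K_eq K_nonempty by fastforce

text \<open>The member of \<open>projected_ifs N T b i\<close> contributed by the letter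
  \<open>k\<close>.\<close>

definition level_map :: "'n \<Rightarrow> nat \<Rightarrow> ('n \<Rightarrow> real) \<Rightarrow> 'n \<Rightarrow> real" where
  "level_map i k = (\<lambda>y\<in>({..i} \<rightarrow>\<^sub>E UNIV). \<lambda>j\<in>{..i}. T k $ j * y j + b k $ j)"

lemma level_map_in: "k \<in> {1..N} \<Longrightarrow> y \<in> open_cube i \<Longrightarrow> level_map i k y \<in> open_cube i"
  using neat unfolding neat_projection_def projected_ifs_def level_map_def by blast

lemma level_map_disjoint:
  assumes "k \<in> {1..N}" "k' \<in> {1..N}" "level_map i k \<noteq> level_map i k'"
  shows "level_map i k ` open_cube i \<inter> level_map i k' ` open_cube i = {}"
  using neat assms unfolding neat_projection_def projected_ifs_def level_map_def disjoint_family_on_def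
  by blast

lemma level_map_apply: "y \<in> {..i} \<rightarrow>\<^sub>E A \<Longrightarrow> j \<le> i \<Longrightarrow> level_map i k y j = T k $ j * y j + b k $ j"
  by (simp add: level_map_def PiE_def)

text \<open>The neat projection condition speaks of the open cube; apply it to points with all
  coordinates \<open>u\<close> and let \<open>u\<close> tend to 0 and to 1.\<close>

lemma b_bounds:
  assumes k: "k \<in> {1..N}"
  shows "0 \<le> b k $ j" "b k $ j + T k $ j \<le> 1"
proof -
  have *: "0 < T k $ j * u + b k $ j \<and> T k $ j * u + b k $ j < 1" if "0 < u" "u < 1" for u
  proof -
    define y where "y = (\<lambda>l\<in>{..j}. u)"
    have y: "y \<in> open_cube j" using that by (auto simp: y_def open_cube_def)
    then have "level_map j k y j = T k $ j * u + b k $ j"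
      unfolding open_cube_def by (subst level_map_apply) (auto simp: y_def)
    then show ?thesis using level_map_in[OF k y] by (force simp: open_cube_def PiE_def Pi_def)
  qed
  have lim: "((\<lambda>u. T k $ j * u + b k $ j) \<longlongrightarrow> T k $ j * c + b k $ j) (at c within A)" for c A
    by (intro tendsto_intros)
  show "0 \<le> b k $ j"
  proof (rule tendsto_lowerbound[of _ _ "at_right 0"])
    show "((\<lambda>u. T k $ j * u + b k $ j) \<longlongrightarrow> b k $ j) (at_right 0)" using lim[of 0] by simp
    show "\<forall>\<^sub>F u in at_right 0. 0 \<le> T k $ j * u + b k $ j"
      by (rule eventually_at_rightI[of 0 1]) (use * in \<open>auto intro: less_imp_le\<close>)
  qed simp
  show "b k $ j + T k $ j \<le> 1"
  proof (rule tendsto_upperbound[of _ _ "at_left 1"])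
    show "((\<lambda>u. T k $ j * u + b k $ j) \<longlongrightarrow> b k $ j + T k $ j) (at_left 1)" using lim[of 1] by (simp add: add.commute)
    show "\<forall>\<^sub>F u in at_left 1. T k $ j * u + b k $ j \<le> 1"
      by (rule eventually_at_leftI[of 0 1]) (use * in \<open>auto intro: less_imp_le\<close>)
  qed simp
qed

text \<open>For \<open>S = {..<i}\<close> this says that two letters induce the same projected map
  below \<open>i\<close>, hence belong to the same fibre. If \<open>i\<close> is the least
  coordinate, \<open>S\<close> is empty and all letters are equivalent, so the first direction is no
  special case.\<close>

definition eqv :: "'n set \<Rightarrow> nat \<Rightarrow> nat \<Rightarrow> bool" where
  "eqv S k k' \<longleftrightarrow> (\<forall>j\<in>S. T k $ j = T k' $ j \<and> b k $ j = b k' $ j)"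

text \<open>If the boxes overlapped in all coordinates up to \<open>i\<close>, the midpoints of the
  overlaps would form a common point of the images of the open cube under two different projected
  maps.\<close>

lemma letter_separated:
  assumes k: "k \<in> {1..N}" "k' \<in> {1..N}" and neq: "\<not> eqv {..i} k k'"
  shows "\<exists>j\<le>i. b k $ j + T k $ j \<le> b k' $ j \<or> b k' $ j + T k' $ j \<le> b k $ j"
proof (rule ccontr)
  assume "\<not> ?thesis"
  then have lt: "b k' $ j < b k $ j + T k $ j" "b k $ j < b k' $ j + T k' $ j" if "j \<le> i" for j
    using that by (meson not_le)+
  define z where "z j = (max (b k $ j) (b k' $ j) + min (b k $ j + T k $ j) (b k' $ j + T k' $ j)) / 2" for j
  have z: "b k $ j < z j" "z j < b k $ j + T k $ j" "b k' $ j < z j" "z j < b k' $ j + T k' $ j" if "j \<le> i" for j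
    using lt[OF that] T_pos[OF k(1), of j] T_pos[OF k(2), of j] unfolding z_def by (auto simp: max_def min_def)
  have im: "(\<lambda>j\<in>{..i}. z j) \<in> level_map i l ` open_cube i"
    if l: "l \<in> {1..N}" and z: "\<And>j. j \<le> i \<Longrightarrow> b l $ j < z j \<and> z j < b l $ j + T l $ j" for l
  proof
    define y where "y = (\<lambda>j\<in>{..i}. (z j - b l $ j) / T l $ j)"
    show y: "y \<in> open_cube i"
      using z T_pos[OF l] by (auto simp: y_def open_cube_def field_simps)
    show "(\<lambda>j\<in>{..i}. z j) = level_map i l y"
      using y T_pos[OF l] unfolding open_cube_def
      by (auto simp: fun_eq_iff level_map_def y_def restrict_def less_imp_neq[THEN not_sym])
  qed
  obtain j where j: "j \<le> i" "T k $ j \<noteq> T k' $ j \<or> b k $ j \<noteq> b k' $ j" using neq by (auto simp: eqv_def)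
  have "level_map i k \<noteq> level_map i k'"
  proof
    assume eq: "level_map i k = level_map i k'"
    have "T k $ j * u + b k $ j = T k' $ j * u + b k' $ j" for u
      using fun_cong[OF fun_cong[OF eq, of "\<lambda>l\<in>{..i}. u"], of j] j(1)
      by (subst (asm) (1 2) level_map_apply) auto
    from this[of 0] this[of 1] show False using j(2) by simp
  qed
  then show False using level_map_disjoint[OF k] im[OF k(1)] im[OF k(2)] z by blast
qed

section \<open>Cylinders\<close>

definition scale :: "nat list \<Rightarrow> 'n \<Rightarrow> real" where
  "scale w j = prod_list (map (\<lambda>k. T k $ j) w)"

primrec shift :: "nat list \<Rightarrow> 'n \<Rightarrow> real" where
  "shift [] j = 0"
| "shift (k # w) j = T k $ j * shift w j + b k $ j"

definition cyl :: "nat list \<Rightarrow> (real, 'n) vec set" where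
  "cyl w = {x. \<exists>y\<in>K. \<forall>j. x $ j = scale w j * y $ j + shift w j}"

lemma scale_simps [simp]: "scale [] j = 1" "scale (k # w) j = T k $ j * scale w j"
  by (simp_all add: scale_def)

lemma scale_append: "scale (v @ w) j = scale v j * scale w j"
  by (simp add: scale_def)

lemma shift_append: "shift (v @ w) j = scale v j * shift w j + shift v j"
  by (induction v) (simp_all add: algebra_simps)

abbreviation word :: "nat list \<Rightarrow> bool" where
  "word w \<equiv> set w \<subseteq> {1..N}"

lemma scale_pos: "word w \<Longrightarrow> 0 < scale w j"
  by (induction w) (auto intro!: mult_pos_pos T_pos)

lemma box_bounds: "word w \<Longrightarrow> 0 \<le> shift w j \<and> shift w j + scale w j \<le> 1"
proof (induction w)
  case (Cons k w)
  then have k: "k \<in> {1..N}" and IH: "0 \<le> shift w j" "shift w j + scale w j \<le> 1" by auto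
  have "T k $ j * (shift w j + scale w j) \<le> T k $ j * 1"
    using IH T_pos[OF k, of j] by (intro mult_left_mono) auto
  then show ?case using IH b_bounds[OF k, of j] T_pos[OF k, of j] by (simp add: distrib_left)
qed simp

lemma box_prefix:
  assumes "word v" "word w"
  shows "shift v j \<le> shift (v @ w) j" "shift (v @ w) j + scale (v @ w) j \<le> shift v j + scale v j"
proof -
  have "scale v j * (shift w j + scale w j) \<le> scale v j * 1"
    using box_bounds[OF assms(2), of j] scale_pos[OF assms(1), of j] by (intro mult_left_mono) auto
  then show "shift v j \<le> shift (v @ w) j" "shift (v @ w) j + scale (v @ w) j \<le> shift v j + scale v j"
    using box_bounds[OF assms(2), of j] scale_pos[OF assms(1), of j]
    by (simp_all add: shift_append scale_append distrib_left)
qed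

lemma cyl_bounds:
  assumes "word w" "x \<in> cyl w"
  shows "shift w j \<le> x $ j" "x $ j \<le> shift w j + scale w j"
  using assms K_cube[of _ j] scale_pos[OF assms(1), of j] by (auto simp: cyl_def mult_left_le)

lemma cyl_Cons: "x \<in> cyl (k # w) \<longleftrightarrow> (\<exists>y\<in>cyl w. x = diag_map (T k) (b k) y)"
proof
  assume "x \<in> cyl (k # w)"
  then obtain y where y: "y \<in> K" "\<And>j. x $ j = scale (k # w) j * y $ j + shift (k # w) j" by (auto simp: cyl_def)
  then have "(\<chi> j. scale w j * y $ j + shift w j) \<in> cyl w" by (auto simp: cyl_def)
  moreover have "x = diag_map (T k) (b k) (\<chi> j. scale w j * y $ j + shift w j)"
    using y(2) by (simp add: diag_map_def vec_eq_iff algebra_simps)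
  ultimately show "\<exists>y\<in>cyl w. x = diag_map (T k) (b k) y" by blast
qed (auto simp: cyl_def diag_map_def algebra_simps intro!: bexI)

lemma cyl_subset: "word w \<Longrightarrow> cyl w \<subseteq> K"
proof (induction w)
  case Nil
  then show ?case by (auto simp: cyl_def simp flip: vec_eq_iff)
next
  case (Cons k w)
  then show ?case using K_inv by (fastforce simp: cyl_Cons)
qed

lemma cyl_prefix: "word w \<Longrightarrow> cyl (v @ w) \<subseteq> cyl v"
proof (induction v)
  case Nil
  have "cyl [] = K" by (auto simp: cyl_def simp flip: vec_eq_iff)
  then show ?case using cyl_subset[OF Nil] by simp
next
  case (Cons k v)
  then show ?case by (fastforce simp: cyl_Cons)
qed

lemma ex_cyl: "x \<in> K \<Longrightarrow> \<exists>w. word w \<and> length w = n \<and> x \<in> cyl w"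
proof (induction n arbitrary: x)
  case 0
  then show ?case by (auto simp: cyl_def)
next
  case (Suc n)
  obtain k y where k: "k \<in> {1..N}" "y \<in> K" "x = diag_map (T k) (b k) y" using K_eq Suc.prems by blast
  obtain w where "word w" "length w = n" "y \<in> cyl w" using Suc.IH[OF k(2)] by blast
  then show ?case using k by (intro exI[of _ "k # w"]) (auto simp: cyl_Cons)
qed

abbreviation weqv :: "'n set \<Rightarrow> nat list \<Rightarrow> nat list \<Rightarrow> bool" where
  "weqv S \<equiv> list_all2 (eqv S)"

lemma eqv_sym: "eqv S k k' \<Longrightarrow> eqv S k' k" and eqv_trans: "eqv S k k' \<Longrightarrow> eqv S k' k'' \<Longrightarrow> eqv S k k''"
  by (auto simp: eqv_def)

lemma weqv_box: "weqv S w w' \<Longrightarrow> j \<in> S \<Longrightarrow> scale w j = scale w' j \<and> shift w j = shift w' j"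
  by (induction rule: list_all2_induct) (auto simp: eqv_def)

text \<open>Words are compared at the first letters that differ on \<open>S\<close>. The set
  \<open>S\<close> must be closed downwards because the separating coordinate may lie below the one
  in which those letters differ.\<close>

lemma word_separated:
  assumes "length w = length w'" "word w" "word w'" "\<not> weqv S w w'"
    and S: "\<And>j j'. j \<in> S \<Longrightarrow> j' \<le> j \<Longrightarrow> j' \<in> S"
  shows "\<exists>j\<in>S. shift w j + scale w j \<le> shift w' j \<or> shift w' j + scale w' j \<le> shift w j"
  using assms(1-4)
proof (induction rule: list_induct2)
  case (Cons k w k' w')
  then have k: "k \<in> {1..N}" "k' \<in> {1..N}" and w: "word w" "word w'" by auto
  show ?case
  proof (cases "eqv S k k'")
    case True
    with Cons w obtain j where j: "j \<in> S" "shift w j + scale w j \<le> shift w' j \<or> shift w' j + scale w' j \<le> shift w j"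
      by auto
    have kk: "T k' $ j = T k $ j" "b k' $ j = b k $ j" using True j(1) by (auto simp: eqv_def)
    have "T k $ j * (shift w j + scale w j) \<le> T k $ j * shift w' j \<or>
        T k $ j * (shift w' j + scale w' j) \<le> T k $ j * shift w j"
      using j(2) T_pos[OF k(1), of j] by auto
    then show ?thesis using j(1) by (intro bexI[of _ j]) (auto simp: kk distrib_left)
  next
    case False
    then obtain i where i: "i \<in> S" "\<not> eqv {i} k k'" by (auto simp: eqv_def)
    then have "\<not> eqv {..i} k k'" by (auto simp: eqv_def)
    then obtain j where j: "j \<le> i" "b k $ j + T k $ j \<le> b k' $ j \<or> b k' $ j + T k' $ j \<le> b k $ j"
      using letter_separated[OF k] by blast
    then show ?thesis using S[OF i(1) j(1)]
        box_prefix[of "[k]" w j] box_prefix[of "[k']" w' j] k w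
      by (intro bexI[of _ j]) auto
  qed
qed simp

section \<open>Gaps in the fibres\<close>

text \<open>The letter \<open>k\<close> only represents its class, that is, the map of the projected
  system below \<open>i\<close>.\<close>

definition full_fibre :: "'n \<Rightarrow> nat \<Rightarrow> bool" where
  "full_fibre i k \<longleftrightarrow> (\<forall>u. 0 \<le> u \<and> u \<le> 1 \<longrightarrow>
     (\<exists>k'\<in>{1..N}. eqv {..<i} k k' \<and> b k' $ i \<le> u \<and> u \<le> b k' $ i + T k' $ i))"

text \<open>From a height \<open>u\<close> missed by the finitely many intervals, the gap extends to
  the nearest end point on either side; inserting 0 and 1 keeps it inside the unit interval.\<close>

lemma fibre_gap:
  assumes "\<not> full_fibre i k"
  shows "\<exists>a g. 0 < g \<and> 0 \<le> a \<and> a + g \<le> 1 \<and>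
    (\<forall>k'\<in>{1..N}. eqv {..<i} k k' \<longrightarrow> b k' $ i + T k' $ i \<le> a \<or> a + g \<le> b k' $ i)"
proof -
  define J where "J = {k'\<in>{1..N}. eqv {..<i} k k'}"
  obtain u where u: "0 \<le> u" "u \<le> 1" "\<And>k'. k' \<in> J \<Longrightarrow> u < b k' $ i \<or> b k' $ i + T k' $ i < u"
    using assms by (auto simp: full_fibre_def J_def not_le)
  define A where "A = insert 0 ((\<lambda>k'. b k' $ i + T k' $ i) ` {k'\<in>J. b k' $ i + T k' $ i < u})"
  define B where "B = insert 1 ((\<lambda>k'. b k' $ i) ` {k'\<in>J. u < b k' $ i})"
  have fin: "finite A" "finite B" by (auto simp: A_def B_def J_def)
  have ne: "A \<noteq> {}" "B \<noteq> {}" by (auto simp: A_def B_def)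
  have "x = 0 \<or> x < u" if "x \<in> A" for x using that by (auto simp: A_def)
  moreover have "0 \<in> A" by (simp add: A_def)
  ultimately have A: "0 \<le> Max A" "Max A = 0 \<or> Max A < u"
    using Max_in[OF fin(1) ne(1)] Max_ge[OF fin(1)] by blast+
  have "x = 1 \<or> u < x" if "x \<in> B" for x using that by (auto simp: B_def)
  moreover have "1 \<in> B" by (simp add: B_def)
  ultimately have B: "Min B \<le> 1" "Min B = 1 \<or> u < Min B"
    using Min_in[OF fin(2) ne(2)] Min_le[OF fin(2)] by blast+
  have "Max A < Min B" using A B u by linarith
  moreover have "b k' $ i + T k' $ i \<le> Max A \<or> Min B \<le> b k' $ i" if "k' \<in> J" for k'
    using u(3)[OF that] that fin by (auto simp: A_def B_def intro!: Max_ge Min_le)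
  ultimately show ?thesis using A B
    by (intro exI[of _ "Max A"] exI[of _ "Min B - Max A"]) (auto simp: J_def)
qed

lemma uniform_fibre_gap:
  assumes "\<And>k. k \<in> {1..N} \<Longrightarrow> \<not> full_fibre i k"
  shows "\<exists>g>0. g \<le> 1 \<and> (\<forall>k\<in>{1..N}. \<exists>a. 0 \<le> a \<and> a + g \<le> 1 \<and>
    (\<forall>k'\<in>{1..N}. eqv {..<i} k k' \<longrightarrow> b k' $ i + T k' $ i \<le> a \<or> a + g \<le> b k' $ i))"
proof -
  obtain a g where ag: "\<And>k. k \<in> {1..N} \<Longrightarrow> 0 < g k \<and> 0 \<le> a k \<and> a k + g k \<le> 1 \<and>
    (\<forall>k'\<in>{1..N}. eqv {..<i} k k' \<longrightarrow> b k' $ i + T k' $ i \<le> a k \<or> a k + g k \<le> b k' $ i)"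
    using fibre_gap[OF assms] by metis
  define g' where "g' = Min (g ` {1..N})"
  have le: "g' \<le> g k" if "k \<in> {1..N}" for k using that unfolding g'_def by (intro Min_le) auto
  have "g' \<in> g ` {1..N}" unfolding g'_def using N_nonempty by (intro Min_in) auto
  then have "0 < g'" "g' \<le> 1" using ag by fastforce+
  moreover have "\<exists>a. 0 \<le> a \<and> a + g' \<le> 1 \<and>
    (\<forall>k'\<in>{1..N}. eqv {..<i} k k' \<longrightarrow> b k' $ i + T k' $ i \<le> a \<or> a + g' \<le> b k' $ i)" if "k \<in> {1..N}" for k
    using ag[OF that] le[OF that] by (intro exI[of _ "a k"]) fastforce
  ultimately show ?thesis by blast
qed

section \<open>Scales that depend only on the column\<close>

definition t_min :: "'n \<Rightarrow> real" where
  "t_min i = Min ((\<lambda>k. T k $ i) ` {1..N})"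

lemma t_min: "0 < t_min i" "k \<in> {1..N} \<Longrightarrow> t_min i \<le> T k $ i"
  unfolding t_min_def using N_nonempty T_pos by (auto simp: Min_gr_iff intro!: Min_le)

lemma t_min_less_1: "t_min i < 1"
  using N_nonempty t_min(2) T_less_1 by (meson all_not_in_conv le_less_trans)

text \<open>The scale in direction \<open>i\<close> is not determined by the column of a word, that is, by its image under the
  projection to the coordinates below \<open>i\<close>; the following bound on it is, so that it can be used as a
  stopping rule for columns.\<close>

definition hat :: "'n \<Rightarrow> nat \<Rightarrow> real" where
  "hat i k = Max ((\<lambda>k'. T k' $ i) ` {k'\<in>{1..N}. eqv {..<i} k k'})"

definition hatw :: "'n \<Rightarrow> nat list \<Rightarrow> real" where
  "hatw i w = prod_list (map (hat i) w)"

lemma hat_ex: 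
  assumes "k \<in> {1..N}"
  shows "\<exists>k'\<in>{1..N}. eqv {..<i} k k' \<and> hat i k = T k' $ i"
proof -
  have "hat i k \<in> (\<lambda>k'. T k' $ i) ` {k'\<in>{1..N}. eqv {..<i} k k'}"
    unfolding hat_def using assms by (intro Max_in) (auto simp: eqv_def)
  then show ?thesis by auto
qed

text \<open>The last claim uses the coordinate ordering: the maximum is attained by a letter that
  agrees with \<open>k\<close> below \<open>i\<close> and contracts more in direction
  \<open>i\<close> than in direction \<open>j\<close>.\<close>

lemma hat_props:
  assumes k: "k \<in> {1..N}"
  shows "T k $ i \<le> hat i k" "t_min i \<le> hat i k" "hat i k < 1" "0 < hat i k" "j < i \<Longrightarrow> hat i k \<le> T k $ j"
proof -
  show 1: "T k $ i \<le> hat i k" unfolding hat_def using k by (intro Max_ge) (auto simp: eqv_def)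
  then show "t_min i \<le> hat i k" "0 < hat i k" using t_min[where i=i] k T_pos by (meson order_trans less_le_trans)+
  obtain k' where k': "k' \<in> {1..N}" "eqv {..<i} k k'" "hat i k = T k' $ i" using hat_ex[OF k] by blast
  then show "hat i k < 1" using T_less_1 by simp
  show "hat i k \<le> T k $ j" if "j < i" using k' T_order[OF k'(1) that] that by (auto simp: eqv_def)
qed

lemma hat_cong: "eqv {..<i} k k' \<Longrightarrow> hat i k = hat i k'"
  unfolding hat_def by (intro arg_cong[where f=Max] image_cong refl) (auto dest: eqv_sym eqv_trans)

lemma hatw_simps [simp]: "hatw i [] = 1" "hatw i (k # w) = hat i k * hatw i w" "hatw i (v @ w) = hatw i v * hatw i w"
  by (simp_all add: hatw_def)

lemma hatw_pos: "word w \<Longrightarrow> 0 < hatw i w"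
  by (induction w) (auto intro!: mult_pos_pos hat_props)

lemma hatw_le_1: "word w \<Longrightarrow> hatw i w \<le> 1"
proof (induction w)
  case (Cons k w)
  then have "hat i k * hatw i w \<le> 1 * 1"
    using hatw_pos[of w i] hat_props(3,4)[of k i] by (intro mult_mono) auto
  then show ?case by simp
qed simp

lemma scale_le_hatw: "word w \<Longrightarrow> scale w i \<le> hatw i w"
proof (induction w)
  case (Cons k w)
  then show ?case using hat_props(1,4)[of k i] scale_pos[of w i] by (auto intro!: mult_mono)
qed simp

lemma hatw_le_scale: "word w \<Longrightarrow> j < i \<Longrightarrow> hatw i w \<le> scale w j"
proof (induction w)
  case (Cons k w)
  then show ?case using hat_props(5)[of k j i] hatw_pos[of w i] T_pos[of k j] by (auto intro!: mult_mono)
qed simp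

lemma hatw_cong: "weqv {..<i} w w' \<Longrightarrow> hatw i w = hatw i w'"
  by (induction rule: list_all2_induct) (auto dest: hat_cong)

text \<open>Take the longest prefix of scale at least \<open>t_min i * r\<close>: were its scale
  above \<open>r\<close>, one more letter could not make it too small. It is proper since
  \<open>w\<close> is too small, so a next letter \<open>k\<close> exists, whose fibre will supply a
  gap.\<close>

lemma ex_prefix_scale:
  assumes "word w" "scale w i < t_min i * r" "r < 1" "0 < r"
  shows "\<exists>v k u. w = v @ k # u \<and> t_min i * r \<le> scale v i \<and> scale v i \<le> r"
  using assms(1,2)
proof (induction w rule: rev_induct)
  case Nil
  have "t_min i * r \<le> 1 * 1" using t_min_less_1[of i] assms(3,4) t_min(1)[of i] by (intro mult_mono) auto
  then show ?case using Nil by simp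
next
  case (snoc k w)
  show ?case
  proof (cases "scale w i < t_min i * r")
    case True
    then obtain v l u where "w = v @ l # u" "t_min i * r \<le> scale v i" "scale v i \<le> r" using snoc by auto
    then show ?thesis by (intro exI[of _ v] exI[of _ l] exI[of _ "u @ [k]"]) simp
  next
    case False
    have "scale w i \<le> r"
    proof (rule ccontr)
      assume "\<not> scale w i \<le> r"
      then have "t_min i * r \<le> T k $ i * scale w i"
        using t_min[where i=i] snoc.prems(1) assms(4) by (intro mult_mono) (auto intro: less_imp_le[OF T_pos])
      then show False using snoc.prems(2) by (simp add: scale_append mult.commute)
    qed
    then show ?thesis using False by (intro exI[of _ w] exI[of _ k] exI[of _ "[]"]) simp
  qed
qed

text \<open>Either the middle third of the interval is free, or it contains a point of the column.
  In the latter case a prefix \<open>v\<close> of the word of that point has a box of height about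
  \<open>L / 3\<close> inside the interval, and the gap of the next fibre is scaled into that
  box.\<close>

lemma column_gap:
  assumes g: "0 < g" "g \<le> 1"
    and gap: "\<And>k. k \<in> {1..N} \<Longrightarrow> \<exists>a. 0 \<le> a \<and> a + g \<le> 1 \<and>
      (\<forall>k'\<in>{1..N}. eqv {..<i} k k' \<longrightarrow> b k' $ i + T k' $ i \<le> a \<or> a + g \<le> b k' $ i)"
    and w: "word w" and L: "3 * hatw i w < t_min i * L" "L \<le> 1"
  shows "\<exists>\<beta>\<ge>\<alpha>. \<beta> + g * t_min i / 3 * L \<le> \<alpha> + L \<and>
    (\<forall>w'. word w' \<longrightarrow> weqv {..<i} w w' \<longrightarrow> (\<forall>y\<in>cyl w'. \<not> (\<beta> < y $ i \<and> y $ i < \<beta> + g * t_min i / 3 * L)))"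
proof -
  define c where "c = g * t_min i / 3"
  have "0 < t_min i * L" using L(1) hatw_pos[OF w, of i] by linarith
  then have L0: "0 < L" using t_min(1)[of i] by (simp add: zero_less_mult_iff)
  have "g * t_min i \<le> 1 * 1" using g t_min_less_1[of i] t_min(1)[of i] by (intro mult_mono) auto
  then have "c \<le> 1 / 3" by (simp add: c_def)
  then have cL: "c * L \<le> 1 / 3 * L" using L0 by (intro mult_right_mono) auto
  show ?thesis unfolding c_def[symmetric]
  proof (cases "\<exists>w'. word w' \<and> weqv {..<i} w w' \<and> (\<exists>y\<in>cyl w'. \<alpha> + L / 3 < y $ i \<and> y $ i < \<alpha> + 2 * L / 3)")
    case False
    show "\<exists>\<beta>\<ge>\<alpha>. \<beta> + c * L \<le> \<alpha> + L \<and>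
      (\<forall>w'. word w' \<longrightarrow> weqv {..<i} w w' \<longrightarrow> (\<forall>y\<in>cyl w'. \<not> (\<beta> < y $ i \<and> y $ i < \<beta> + c * L)))"
    proof (intro exI[of _ "\<alpha> + L / 3"] conjI allI impI ballI notI)
      fix w' y assume "word w'" "weqv {..<i} w w'" "y \<in> cyl w'" "\<alpha> + L / 3 < y $ i \<and> y $ i < \<alpha> + L / 3 + c * L"
      moreover from this have "y $ i < \<alpha> + 2 * L / 3" using cL by linarith
      ultimately show False using False by blast
    qed ((use L0 cL in linarith)+)
  next
    case True
    then obtain w' y where w': "word w'" "weqv {..<i} w w'" "y \<in> cyl w'" "\<alpha> + L / 3 < y $ i" "y $ i < \<alpha> + 2 * L / 3"
      by blast
    have "scale w' i < t_min i * (L / 3)"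
      using scale_le_hatw[OF w'(1), of i] hatw_cong[OF w'(2)] L(1) by simp
    then obtain v k u where v: "w' = v @ k # u" "t_min i * (L / 3) \<le> scale v i" "scale v i \<le> L / 3"
      using ex_prefix_scale[OF w'(1), of i "L / 3"] L0 L(2) by auto
    have vk: "word v" "k \<in> {1..N}" "word (k # u)" using w'(1) v(1) by auto
    obtain a where a: "0 \<le> a" "a + g \<le> 1"
      "\<And>k'. k' \<in> {1..N} \<Longrightarrow> eqv {..<i} k k' \<Longrightarrow> b k' $ i + T k' $ i \<le> a \<or> a + g \<le> b k' $ i"
      using gap[OF vk(2)] by blast
    define \<beta> where "\<beta> = scale v i * a + shift v i"
    note sv = scale_pos[OF vk(1), of i]
    have len: "c * L \<le> scale v i * g" using mult_right_mono[OF v(2), of g] g by (simp add: c_def mult_ac)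
    have inside: "shift v i \<le> \<beta>" "\<beta> + c * L \<le> shift v i + scale v i"
    proof -
      show "shift v i \<le> \<beta>" using sv a by (simp add: \<beta>_def)
      have "scale v i * (a + g) \<le> scale v i * 1" using a sv by (intro mult_left_mono) auto
      then show "\<beta> + c * L \<le> shift v i + scale v i" using len by (simp add: \<beta>_def distrib_left)
    qed
    have "y \<in> cyl v" using cyl_prefix[OF vk(3), of v] w'(3) v(1) by blast
    note yv = cyl_bounds[OF vk(1) this, of i]
    have free: "\<not> (\<beta> < y $ i \<and> y $ i < \<beta> + c * L)" if x: "word x" "weqv {..<i} w x" "y \<in> cyl x" for x y
    proof -
      have "weqv {..<i} w' x"
        using list_all2_trans[of "eqv {..<i}" "eqv {..<i}" "eqv {..<i}" w' w x] w'(2) x(2)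
        by (metis eqv_sym eqv_trans list_all2_conv_all_nth)
      then obtain v' k' u' where v': "x = v' @ k' # u'" "weqv {..<i} v v'" "eqv {..<i} k k'"
        unfolding v(1) by (auto simp: list_all2_append1 list_all2_Cons1)
      have v'k': "word v'" "k' \<in> {1..N}" "word (k' # u')" "word u'" "word (v' @ [k'])" using x(1) v'(1) by auto
      have yv': "y \<in> cyl v'" using cyl_prefix[OF v'k'(3), of v'] x(3) v'(1) by blast
      \<comment> \<open>Either the prefix of \<open>x\<close> has the same box as \<open>v\<close>
        up to \<open>i\<close>, and its next letter avoids the same fibre gap, or the two boxes are
        separated; as they agree below \<open>i\<close>, only direction \<open>i\<close> can
        separate them.\<close>
      show ?thesis
      proof (cases "weqv {..i} v v'")
        case True
        then have eq: "scale v' i = scale v i" "shift v' i = shift v i" using weqv_box[of "{..i}" v v' i] by auto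
        have "y \<in> cyl (v' @ [k'])" using cyl_prefix[OF v'k'(4), of "v' @ [k']"] x(3) v'(1) by auto
        note cyl_bounds[OF v'k'(5) this, of i]
        then have y: "scale v i * b k' $ i + shift v i \<le> y $ i"
          "y $ i \<le> scale v i * (b k' $ i + T k' $ i) + shift v i"
          by (auto simp: shift_append scale_append eq algebra_simps)
        from a(3)[OF v'k'(2) v'(3)] show ?thesis
        proof
          assume "b k' $ i + T k' $ i \<le> a"
          then have "scale v i * (b k' $ i + T k' $ i) \<le> scale v i * a" using sv by simp
          then show ?thesis using y by (simp add: \<beta>_def)
        next
          assume "a + g \<le> b k' $ i"
          then have "scale v i * (a + g) \<le> scale v i * b k' $ i" using sv by simp
          then show ?thesis using y len by (simp add: \<beta>_def distrib_left)
        qed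
      next
        case False
        then have "\<exists>j\<in>{..i}. shift v j + scale v j \<le> shift v' j \<or> shift v' j + scale v' j \<le> shift v j"
          using list_all2_lengthD[OF v'(2)] vk(1) v'k'(1) by (intro word_separated) auto
        then obtain j where j: "j \<le> i" "shift v j + scale v j \<le> shift v' j \<or> shift v' j + scale v' j \<le> shift v j"
          by auto
        have "j = i"
        proof (rule ccontr)
          assume "j \<noteq> i"
          then have "j < i" using j(1) by simp
          then have "scale v j = scale v' j \<and> shift v j = shift v' j" using weqv_box[OF v'(2)] by simp
          then show False using j(2) scale_pos[OF vk(1), of j] by simp
        qed
        then show ?thesis using j(2) cyl_bounds[OF v'k'(1) yv', of i] inside by auto
      qed
    qed
    show "\<exists>\<beta>\<ge>\<alpha>. \<beta> + c * L \<le> \<alpha> + L \<and>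
      (\<forall>w'. word w' \<longrightarrow> weqv {..<i} w w' \<longrightarrow> (\<forall>y\<in>cyl w'. \<not> (\<beta> < y $ i \<and> y $ i < \<beta> + c * L)))"
    proof (intro exI[of _ \<beta>] conjI)
      show "\<alpha> \<le> \<beta>" using inside yv v(3) w'(4) by linarith
      show "\<beta> + c * L \<le> \<alpha> + L" using inside yv v(3) w'(5) by linarith
    qed (use free in blast)
  qed
qed

section \<open>Columns\<close>

definition stopped :: "'n \<Rightarrow> real \<Rightarrow> nat list \<Rightarrow> bool" where
  "stopped i r w \<longleftrightarrow> word w \<and> hatw i w \<le> r \<and> w \<noteq> [] \<and> r < hatw i (butlast w)"

text \<open>Long words have small \<open>hatw\<close>, since all \<open>hat i k\<close> are bounded
  by some \<open>s < 1\<close>. A shortest word around \<open>x\<close> with \<open>hatw\<close> at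
  most \<open>r\<close> is stopped; it is nonempty because \<open>hatw i [] = 1\<close>.\<close>

lemma ex_stopped:
  assumes x: "x \<in> K" and r: "0 < r" "r < 1"
  shows "\<exists>w. stopped i r w \<and> x \<in> cyl w"
proof -
  define s where "s = Max (hat i ` {1..N})"
  have s: "hat i k \<le> s" if "k \<in> {1..N}" for k using that unfolding s_def by (intro Max_ge) auto
  have "s \<in> hat i ` {1..N}" unfolding s_def using N_nonempty by (intro Max_in) auto
  then have s01: "0 < s" "s < 1" using hat_props(3,4) by auto
  obtain n where n: "s ^ n < r" using real_arch_pow_inv[OF r(1) s01(2)] by blast
  have "hatw i w \<le> s ^ length w" if "word w" for w
    using that
  proof (induction w)
    case (Cons k w)
    then show ?case using s[of k] hatw_pos[of w i] s01 by (auto intro!: mult_mono)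
  qed simp
  moreover obtain w0 where "word w0" "length w0 = n" "x \<in> cyl w0" using ex_cyl[OF x] by blast
  ultimately have "word w0 \<and> x \<in> cyl w0 \<and> hatw i w0 \<le> r" using n by fastforce
  then obtain w where w: "word w" "x \<in> cyl w" "hatw i w \<le> r"
    and least: "\<And>v. word v \<Longrightarrow> x \<in> cyl v \<Longrightarrow> hatw i v \<le> r \<Longrightarrow> length w \<le> length v"
    using ex_has_least_nat[of "\<lambda>w. word w \<and> x \<in> cyl w \<and> hatw i w \<le> r" w0 length] by blast
  have ne: "w \<noteq> []" using w(3) r(2) by auto
  have wl: "w = butlast w @ [last w]" using ne by simp
  have wb: "word (butlast w)" "word [last w]" using w(1) last_in_set[OF ne] by (auto dest: in_set_butlastD)
  have "x \<in> cyl (butlast w)" using cyl_prefix[OF wb(2), of "butlast w"] w(2) wl by auto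
  moreover have "\<not> length w \<le> length (butlast w)" using ne by (cases w) auto
  ultimately have "r < hatw i (butlast w)" using least[OF wb(1)] by (meson not_le)
  then show ?thesis using w ne by (auto simp: stopped_def)
qed

lemma stopped_ge: 
  assumes "stopped i r w" "0 < r"
  shows "t_min i * r \<le> hatw i w"
proof -
  have w: "word w" "w \<noteq> []" "r < hatw i (butlast w)" using assms by (auto simp: stopped_def)
  then have l: "last w \<in> {1..N}" using last_in_set by blast
  have "t_min i * r \<le> hat i (last w) * hatw i (butlast w)"
    using hat_props(2,4)[OF l, of i] w assms(2) by (intro mult_mono) auto
  also have "\<dots> = hatw i (butlast w @ [last w])" by simp
  finally show ?thesis using w(2) by simp
qed

text \<open>By \<open>word_separated\<close>, a common point of the open boxes below
  \<open>i\<close> forces the prefixes of equal length into the same column. The stopping rule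
  depends only on the column, so neither word can be longer.\<close>

lemma stopped_eqv:
  assumes w: "stopped i r w" "stopped i r w'"
    and common: "\<And>j. j < i \<Longrightarrow> shift w j < z j \<and> z j < shift w j + scale w j \<and> shift w' j < z j \<and> z j < shift w' j + scale w' j"
  shows "weqv {..<i} w w'"
proof -
  have *: "weqv {..<i} w w'" if len: "length w \<le> length w'" and w: "stopped i r w" "stopped i r w'"
    and common: "\<And>j. j < i \<Longrightarrow> shift w j < z j \<and> z j < shift w j + scale w j \<and> shift w' j < z j \<and> z j < shift w' j + scale w' j"
    for w w'
  proof -
    define v u where "v = take (length w) w'" and "u = drop (length w) w'"
    have w': "w' = v @ u" by (simp add: v_def u_def)
    have words: "word w" "word v" "word u" and lv: "length v = length w"
      using w len by (auto simp: stopped_def v_def u_def dest: in_set_takeD in_set_dropD)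
    have "weqv {..<i} w v"
    proof (rule ccontr)
      assume "\<not> ?thesis"
      then have "\<exists>j\<in>{..<i}. shift w j + scale w j \<le> shift v j \<or> shift v j + scale v j \<le> shift w j"
        by (intro word_separated) (use lv words in auto)
      then obtain j where j: "j < i" "shift w j + scale w j \<le> shift v j \<or> shift v j + scale v j \<le> shift w j"
        by auto
      then show False using common[OF j(1)] box_prefix[OF words(2,3), of j] unfolding w' by linarith
    qed
    moreover have "u = []"
    proof (rule ccontr)
      assume u: "u \<noteq> []"
      have "hatw i v * hatw i (butlast u) \<le> hatw i v * 1"
        using hatw_pos[OF words(2), of i] hatw_le_1[of "butlast u" i] words(3)
        by (intro mult_left_mono) (auto dest: in_set_butlastD)
      then have "hatw i (butlast w') \<le> hatw i w"
        using hatw_cong[OF \<open>weqv {..<i} w v\<close>] u by (simp add: w' butlast_append)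
      then show False using w by (simp add: stopped_def)
    qed
    ultimately show ?thesis by (simp add: w')
  qed
  show ?thesis
  proof (cases "length w \<le> length w'")
    case True
    then show ?thesis by (rule *) (use w common in auto)
  next
    case False
    then have "weqv {..<i} w' w" by (intro *) (use w common in auto)
    then show ?thesis by (simp add: list_all2_conv_all_nth eqv_sym)
  qed
qed

text \<open>Take the first grid point above \<open>A\<close>, or above \<open>x - 2 * \<rho>\<close>
  if that is larger; the step \<open>\<rho> / 2\<close> is too short to jump over the interval, and
  the truncation bounds \<open>m\<close>.\<close>

lemma grid_point:
  fixes A B x y \<rho> :: real
  assumes "0 < \<rho>" "\<rho> \<le> B - A" "A \<le> y" "y \<le> B" "\<bar>y - x\<bar> \<le> \<rho>"
  shows "\<exists>m::int\<in>{-4..4}. A < x + of_int m * (\<rho> / 2) \<and> x + of_int m * (\<rho> / 2) < B"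
proof -
  define A' where "A' = max A (x - 2 * \<rho>)"
  define m where "m = \<lfloor>(A' - x) / (\<rho> / 2)\<rfloor> + 1"
  have m: "(A' - x) / (\<rho> / 2) < of_int m" "of_int m \<le> (A' - x) / (\<rho> / 2) + 1" by (simp_all add: m_def)
  have m1: "A' - x < of_int m * (\<rho> / 2)" using m(1) assms(1) by (simp add: field_simps)
  have "of_int m * (\<rho> / 2) \<le> ((A' - x) / (\<rho> / 2) + 1) * (\<rho> / 2)" using m(2) assms(1) by (intro mult_right_mono) auto
  also have "\<dots> = A' - x + \<rho> / 2" using assms(1) by (simp add: field_simps)
  finally have m2: "of_int m * (\<rho> / 2) \<le> A' - x + \<rho> / 2" .
  have "x - 2 * \<rho> \<le> A'" "A' \<le> x + \<rho>" using assms by (auto simp: A'_def abs_le_iff)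
  then have "(-4) * (\<rho> / 2) < of_int m * (\<rho> / 2)" "of_int m * (\<rho> / 2) \<le> 3 * (\<rho> / 2)" using m1 m2 by linarith+
  then have "(-4::real) < of_int m" "of_int m \<le> (3::real)"
    using assms(1) by (simp_all only: mult_less_cancel_right mult_le_cancel_right)
  then have "m \<in> {-4..4}" by auto
  moreover have "A < x + of_int m * (\<rho> / 2)" using m1 max.cobounded1[of A "x - 2 * \<rho>"] unfolding A'_def by linarith
  moreover have "x + of_int m * (\<rho> / 2) < B" using m2 assms by (auto simp: A'_def max_def split: if_splits)
  ultimately show ?thesis by blast
qed

text \<open>Each member of \<open>F\<close> is handled inside the gap found for the previous ones,
  at the cost of a factor \<open>c\<close>. \<open>L\<^sub>0\<close> is the least length at which
  gaps are available.\<close>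

lemma iterate_gaps:
  fixes Z :: "'q \<Rightarrow> real set"
  assumes "finite F" and c: "0 < c" "c \<le> 1"
    and gap: "\<And>p \<alpha> L. p \<in> F \<Longrightarrow> L\<^sub>0 \<le> L \<Longrightarrow> L \<le> 1 \<Longrightarrow>
      \<exists>\<beta>\<ge>\<alpha>. \<beta> + c * L \<le> \<alpha> + L \<and> (\<forall>z\<in>Z p. \<not> (\<beta> < z \<and> z < \<beta> + c * L))"
    and L: "0 < L" "L \<le> 1" "L\<^sub>0 \<le> c ^ card F * L"
  shows "\<exists>\<beta>\<ge>\<alpha>. \<beta> + c ^ card F * L \<le> \<alpha> + L \<and> (\<forall>p\<in>F. \<forall>z\<in>Z p. \<not> (\<beta> < z \<and> z < \<beta> + c ^ card F * L))"
  using assms(1) gap L(3)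
proof (induction F)
  case empty
  then show ?case by auto
next
  case (insert p F)
  define L' where "L' = c ^ card F * L"
  have L'0: "0 < L'" using c L by (simp add: L'_def)
  have "c ^ card F * L \<le> 1 * 1" using c L by (intro mult_mono power_le_one) auto
  then have L'1: "L' \<le> 1" by (simp add: L'_def)
  have cL': "c * L' = c ^ card (insert p F) * L" using insert by (simp add: L'_def)
  have "c * L' \<le> 1 * L'" using c L'0 by (intro mult_right_mono) auto
  then have L0L': "L\<^sub>0 \<le> L'" using insert.prems(2) cL' by simp
  obtain \<beta> where \<beta>: "\<alpha> \<le> \<beta>" "\<beta> + L' \<le> \<alpha> + L" "\<And>p z. p \<in> F \<Longrightarrow> z \<in> Z p \<Longrightarrow> \<not> (\<beta> < z \<and> z < \<beta> + L')"
    using insert.IH[OF insert.prems(1)] L0L' unfolding L'_def by blast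
  obtain \<beta>' where \<beta>': "\<beta> \<le> \<beta>'" "\<beta>' + c * L' \<le> \<beta> + L'" "\<And>z. z \<in> Z p \<Longrightarrow> \<not> (\<beta>' < z \<and> z < \<beta>' + c * L')"
    using insert.prems(1)[OF insertI1 L0L' L'1] by blast
  show ?case unfolding cL'[symmetric]
  proof (intro exI[of _ \<beta>'] conjI ballI)
    fix p' z assume "p' \<in> insert p F" "z \<in> Z p'"
    then show "\<not> (\<beta>' < z \<and> z < \<beta>' + c * L')" using \<beta>(3)[of p' z] \<beta>' by auto
  qed (use \<beta> \<beta>' in auto)
qed

section \<open>Separated neighbourhoods at every scale\<close>

text \<open>Size and separation are measured in the coordinates of \<open>S\<close> alone;
  \<open>E\<close> may be large in the others. For empty \<open>S\<close> the choice
  \<open>E = K\<close> works.\<close>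

definition isolated :: "'n set \<Rightarrow> real \<Rightarrow> bool" where
  "isolated S c \<longleftrightarrow> 0 < c \<and> (\<forall>x\<in>K. \<forall>R. 0 < R \<longrightarrow> R \<le> 1 \<longrightarrow> (\<exists>E\<subseteq>K. x \<in> E \<and>
     (\<forall>y\<in>E. \<forall>j\<in>S. \<bar>y $ j - x $ j\<bar> \<le> R) \<and> (\<forall>y\<in>E. \<forall>y'\<in>K - E. \<exists>j\<in>S. c * R \<le> \<bar>y $ j - y' $ j\<bar>)))"

text \<open>The neighbourhood \<open>E\<close> for a much smaller scale lies in at most
  \<open>card F\<close> columns, so nested gaps leave a common gap on each side of \<open>x\<close>.
  The part of \<open>E\<close> between these gaps is separated from the rest of \<open>E\<close> in
  direction \<open>i\<close> and from \<open>K - E\<close> in a lower direction.\<close>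

lemma isolated_step:
  assumes iso: "isolated {..<i} c\<^sub>0" and nf: "\<And>k. k \<in> {1..N} \<Longrightarrow> \<not> full_fibre i k"
  shows "\<exists>c. isolated {..i} c"
proof -
  obtain g where g: "0 < g" "g \<le> 1" and gap: "\<And>k. k \<in> {1..N} \<Longrightarrow> \<exists>a. 0 \<le> a \<and> a + g \<le> 1 \<and>
      (\<forall>k'\<in>{1..N}. eqv {..<i} k k' \<longrightarrow> b k' $ i + T k' $ i \<le> a \<or> a + g \<le> b k' $ i)"
    using uniform_fibre_gap[OF nf] by meson
  note tm = t_min(1)[of i] t_min_less_1[of i]
  define c where "c = g * t_min i / 3"
  have "g * t_min i \<le> 1 * 1" using g tm by (intro mult_mono) auto
  then have c: "0 < c" "c \<le> 1" using g tm by (auto simp: c_def)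
  define F where "F = {..<i} \<rightarrow>\<^sub>E {-4..4::int}"
  have finF: "finite F" by (auto simp: F_def intro: finite_PiE)
  define G where "G = c ^ card F"
  have G: "0 < G" "G \<le> 1" using c by (auto simp: G_def power_le_one)
  have c0: "0 < c\<^sub>0" using iso by (simp add: isolated_def)
  define c\<^sub>1 where "c\<^sub>1 = min G (c\<^sub>0 * (t_min i * (t_min i * G / 6)))"
  have "isolated {..i} c\<^sub>1" unfolding isolated_def
  proof (intro conjI ballI allI impI)
    show "0 < c\<^sub>1" using G c0 tm by (simp add: c\<^sub>1_def)
    fix x R assume x: "x \<in> K" and R: "0 < R" "R \<le> (1::real)"
    \<comment> \<open>The divisor 6 makes columns stopped at \<open>r\<close> thin enough for
      \<open>column_gap\<close> at all lengths from \<open>G * R\<close> upwards.\<close>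
    define r where "r = t_min i * G * R / 6"
    \<comment> \<open>A stopped word has width at least \<open>\<rho>\<close> in every direction
      below \<open>i\<close>, by \<open>stopped_ge\<close> and \<open>hatw_le_scale\<close>, so its
      box contains a grid point of step \<open>\<rho> / 2\<close>.\<close>
    define \<rho> where "\<rho> = t_min i * r"
    have "t_min i * G * R \<le> 1 * 1 * R" using tm G R by (intro mult_mono mult_right_mono) auto
    then have "r \<le> R / 6" by (simp add: r_def)
    moreover have "0 < r" using tm G R by (simp add: r_def)
    ultimately have r: "0 < r" "r < 1" "r \<le> R" using R by linarith+
    have "t_min i * r \<le> 1 * r" using tm r by (intro mult_right_mono) auto
    then have "\<rho> \<le> r" by (simp add: \<rho>_def)
    moreover have "0 < \<rho>" using tm r by (simp add: \<rho>_def)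
    ultimately have \<rho>: "0 < \<rho>" "\<rho> \<le> 1" "\<rho> \<le> R" using r by linarith+
    obtain E where E: "E \<subseteq> K" "x \<in> E" "\<And>y j. y \<in> E \<Longrightarrow> j < i \<Longrightarrow> \<bar>y $ j - x $ j\<bar> \<le> \<rho>"
      "\<And>y y'. y \<in> E \<Longrightarrow> y' \<in> K - E \<Longrightarrow> \<exists>j<i. c\<^sub>0 * \<rho> \<le> \<bar>y $ j - y' $ j\<bar>"
      using iso x \<rho> unfolding isolated_def by (metis lessThan_iff)
    \<comment> \<open>A column is identified by a grid point in its open box, so at most \<open>card F\<close> columns are relevant.\<close>
    define key where "key p w \<longleftrightarrow> stopped i r w \<and> (\<forall>j<i. shift w j < x $ j + of_int (p j) * (\<rho> / 2) \<and>
      x $ j + of_int (p j) * (\<rho> / 2) < shift w j + scale w j)" for p :: "'n \<Rightarrow> int" and w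
    define Z where "Z p = {y $ i | y w. y \<in> cyl w \<and> key p w}" for p
    have key_ex: "\<exists>p\<in>F. y $ i \<in> Z p" if y: "y \<in> E" for y
    proof -
      obtain w where w: "stopped i r w" "y \<in> cyl w" using ex_stopped r y E(1) by blast
      then have word: "word w" by (simp add: stopped_def)
      have "\<exists>m::int\<in>{-4..4}. shift w j < x $ j + of_int m * (\<rho> / 2) \<and> x $ j + of_int m * (\<rho> / 2) < shift w j + scale w j"
        if j: "j < i" for j
      proof (rule grid_point[OF \<rho>(1) _ cyl_bounds[OF word w(2)] E(3)[OF y j]])
        show "\<rho> \<le> shift w j + scale w j - shift w j"
          using stopped_ge[OF w(1) r(1)] hatw_le_scale[OF word j] by (simp add: \<rho>_def)
      qed
      then obtain p :: "'n \<Rightarrow> int" where p: "\<And>j. j < i \<Longrightarrow> p j \<in> {-4..4} \<and> shift w j < x $ j + of_int (p j) * (\<rho> / 2) \<and>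
          x $ j + of_int (p j) * (\<rho> / 2) < shift w j + scale w j"
        by metis
      then have "key (restrict p {..<i}) w" "restrict p {..<i} \<in> F" using w(1) by (auto simp: key_def F_def)
      then show ?thesis using w(2) by (auto simp: Z_def)
    qed
    have gaps: "\<exists>\<beta>\<ge>\<alpha>. \<beta> + G * R \<le> \<alpha> + R \<and> (\<forall>y\<in>E. \<not> (\<beta> < y $ i \<and> y $ i < \<beta> + G * R))" for \<alpha>
    proof -
      have "\<exists>\<beta>\<ge>\<alpha>. \<beta> + G * R \<le> \<alpha> + R \<and> (\<forall>p\<in>F. \<forall>z\<in>Z p. \<not> (\<beta> < z \<and> z < \<beta> + G * R))"
        unfolding G_def
      proof (rule iterate_gaps[OF finF c _ R, of "G * R"])
        fix p \<alpha> L assume L: "G * R \<le> L" "L \<le> 1"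
        show "\<exists>\<beta>\<ge>\<alpha>. \<beta> + c * L \<le> \<alpha> + L \<and> (\<forall>z\<in>Z p. \<not> (\<beta> < z \<and> z < \<beta> + c * L))"
        proof (cases "\<exists>w. key p w")
          case True
          then obtain w where w: "key p w" by blast
          then have word: "word w" and "hatw i w \<le> r" by (auto simp: key_def stopped_def)
          moreover have "t_min i * (G * R) \<le> t_min i * L" using L(1) tm by simp
          moreover have "0 < t_min i * (G * R)" using tm G R by simp
          ultimately have "3 * hatw i w < t_min i * L" by (simp add: r_def mult.assoc)
          then obtain \<beta> where \<beta>: "\<alpha> \<le> \<beta>" "\<beta> + c * L \<le> \<alpha> + L"
            "\<And>w' y. word w' \<Longrightarrow> weqv {..<i} w w' \<Longrightarrow> y \<in> cyl w' \<Longrightarrow> \<not> (\<beta> < y $ i \<and> y $ i < \<beta> + c * L)"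
            using column_gap[OF g gap word _ L(2)] unfolding c_def by blast
          have "\<not> (\<beta> < z \<and> z < \<beta> + c * L)" if z: "z \<in> Z p" for z
          proof -
            obtain y w' where y: "z = y $ i" "y \<in> cyl w'" "key p w'" using z by (auto simp: Z_def)
            have "weqv {..<i} w w'"
              by (rule stopped_eqv[of i r w w' "\<lambda>j. x $ j + of_int (p j) * (\<rho> / 2)"])
                (use w y(3) in \<open>auto simp: key_def\<close>)
            then show ?thesis using \<beta>(3)[of w' y] y by (auto simp: key_def stopped_def)
          qed
          then show ?thesis using \<beta> by blast
        next
          case False
          have "c * L \<le> 1 * L" using c L G R by (intro mult_right_mono) (auto intro: order_trans[OF _ L(1)])
          then show ?thesis using False by (intro exI[of _ \<alpha>]) (auto simp: Z_def)
        qed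
      qed (simp add: G_def)
      then show ?thesis using key_ex by meson
    qed
    obtain \<beta> where \<beta>: "x $ i \<le> \<beta>" "\<beta> + G * R \<le> x $ i + R" "\<And>y. y \<in> E \<Longrightarrow> \<not> (\<beta> < y $ i \<and> y $ i < \<beta> + G * R)"
      using gaps[of "x $ i"] by blast
    obtain \<gamma> where \<gamma>: "x $ i - R \<le> \<gamma>" "\<gamma> + G * R \<le> x $ i" "\<And>y. y \<in> E \<Longrightarrow> \<not> (\<gamma> < y $ i \<and> y $ i < \<gamma> + G * R)"
      using gaps[of "x $ i - R"] by auto
    have GR: "0 < G * R" using G R by simp
    have c1R: "c\<^sub>1 * R \<le> G * R" "c\<^sub>1 * R \<le> c\<^sub>0 * \<rho>"
    proof -
      show "c\<^sub>1 * R \<le> G * R" using R by (intro mult_right_mono) (auto simp: c\<^sub>1_def)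
      have "c\<^sub>1 * R \<le> (c\<^sub>0 * (t_min i * (t_min i * G / 6))) * R" using R by (intro mult_right_mono) (auto simp: c\<^sub>1_def)
      then show "c\<^sub>1 * R \<le> c\<^sub>0 * \<rho>" by (simp add: \<rho>_def r_def mult_ac)
    qed
    show "\<exists>E\<subseteq>K. x \<in> E \<and> (\<forall>y\<in>E. \<forall>j\<in>{..i}. \<bar>y $ j - x $ j\<bar> \<le> R) \<and>
      (\<forall>y\<in>E. \<forall>y'\<in>K - E. \<exists>j\<in>{..i}. c\<^sub>1 * R \<le> \<bar>y $ j - y' $ j\<bar>)"
    proof (intro exI[of _ "{y\<in>E. \<gamma> + G * R \<le> y $ i \<and> y $ i \<le> \<beta>}"] conjI ballI)
      fix y j assume y: "y \<in> {y\<in>E. \<gamma> + G * R \<le> y $ i \<and> y $ i \<le> \<beta>}" and j: "j \<in> {..i}"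
      show "\<bar>y $ j - x $ j\<bar> \<le> R"
      proof (cases "j = i")
        case True
        then show ?thesis using y \<beta> \<gamma> GR by auto
      next
        case False
        then have "\<bar>y $ j - x $ j\<bar> \<le> \<rho>" using E(3)[of y j] y j by auto
        then show ?thesis using \<rho>(3) by linarith
      qed
    next
      fix y y' assume y: "y \<in> {y\<in>E. \<gamma> + G * R \<le> y $ i \<and> y $ i \<le> \<beta>}"
        and y': "y' \<in> K - {y\<in>E. \<gamma> + G * R \<le> y $ i \<and> y $ i \<le> \<beta>}"
      show "\<exists>j\<in>{..i}. c\<^sub>1 * R \<le> \<bar>y $ j - y' $ j\<bar>"
      proof (cases "y' \<in> E")
        case True
        then have "G * R \<le> \<bar>y $ i - y' $ i\<bar>" using y y' \<beta>(3)[OF True] \<gamma>(3)[OF True] by auto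
        then have "c\<^sub>1 * R \<le> \<bar>y $ i - y' $ i\<bar>" using c1R(1) by linarith
        then show ?thesis by (intro bexI[of _ i]) auto
      next
        case False
        then obtain j where "j < i" "c\<^sub>0 * \<rho> \<le> \<bar>y $ j - y' $ j\<bar>" using E(4)[of y y'] y y' by blast
        then have "j \<in> {..i}" "c\<^sub>1 * R \<le> \<bar>y $ j - y' $ j\<bar>" using c1R(2) by auto
        then show ?thesis by blast
      qed
    qed (use E \<beta> \<gamma> in auto)
  qed
  then show ?thesis by blast
qed

text \<open>Coordinates are added in increasing order. Restricting to downward closed sets makes
  each intermediate set of the form \<open>{..<i}\<close>, to which \<open>isolated_step\<close>
  applies.\<close>

lemma ex_isolated:
  assumes nf: "\<And>i k. k \<in> {1..N} \<Longrightarrow> \<not> full_fibre i k"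
  shows "\<exists>c. isolated UNIV c"
proof -
  have "(\<forall>i\<in>S. {..i} \<subseteq> S) \<longrightarrow> (\<exists>c. isolated S c)" if "finite S" for S :: "'n set"
    using that
  proof (induction S rule: finite_linorder_max_induct)
    case empty
    have "isolated {} 1" unfolding isolated_def by (auto intro!: exI[of _ K])
    then show ?case by blast
  next
    case (insert i A)
    show ?case
    proof
      assume cl: "\<forall>j\<in>insert i A. {..j} \<subseteq> insert i A"
      have A: "A = {..<i}"
      proof
        show "A \<subseteq> {..<i}" using insert.hyps by auto
        have "{..<i} \<subseteq> {..i} - {i}" by auto
        also have "\<dots> \<subseteq> A" using cl by blast
        finally show "{..<i} \<subseteq> A" .
      qed
      have "\<forall>j\<in>A. {..j} \<subseteq> A" unfolding A by auto
      then obtain c where "isolated {..<i} c" using insert.IH A by auto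
      then have "\<exists>c. isolated {..i} c" using nf by (rule isolated_step)
      moreover have "insert i A = {..i}" unfolding A by auto
      ultimately show "\<exists>c. isolated (insert i A) c" by simp
    qed
  qed
  from this[of UNIV] show ?thesis by simp
qed

text \<open>A chain with steps shorter than the separation of \<open>E\<close> cannot leave
  \<open>E\<close>, yet its last point is too far from the first to lie in \<open>E\<close>.\<close>

lemma uniformly_disconnected_if_not_full:
  assumes nf: "\<And>i k. k \<in> {1..N} \<Longrightarrow> \<not> full_fibre i k"
  shows "uniformly_disconnected K dist"
proof -
  obtain c where c: "isolated UNIV c" using ex_isolated[OF nf] by blast
  then have c0: "0 < c" by (simp add: isolated_def)
  define d where "d = real CARD('n)"
  have d: "1 \<le> d" by (simp add: d_def Suc_leI)
  have comp: "\<bar>x $ j - y $ j\<bar> \<le> dist x y" for x y :: "(real, 'n) vec" and j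
    using component_le_norm_cart[of "x - y" j] by (simp add: dist_norm)
  have "\<not> delta_sequence K dist (c / (4 * d)) n x" for n x
  proof
    assume ds: "delta_sequence K dist (c / (4 * d)) n x"
    then have n: "1 \<le> n" and xK: "\<And>i. i \<le> n \<Longrightarrow> x i \<in> K" and inj: "inj_on x {0..n}"
      and steps: "\<And>i. i < n \<Longrightarrow> dist (x i) (x (Suc i)) \<le> c / (4 * d) * dist (x 0) (x n)"
      by (auto simp: delta_sequence_def)
    have "x 0 \<noteq> x n" using inj n by (auto simp: inj_on_eq_iff)
    then have D: "0 < dist (x 0) (x n)" by simp
    \<comment> \<open>Points of \<open>E\<close> are then within half the distance of the end points
      from \<open>x 0\<close>, and the steps are at most \<open>c * R / 2\<close>.\<close>
    define R where "R = dist (x 0) (x n) / (2 * d)"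
    have "\<bar>x 0 $ j - x n $ j\<bar> \<le> 1" for j
      using K_cube[OF xK[of 0], of j] K_cube[OF xK[of n], of j] by (simp add: abs_le_iff)
    then have "dist (x 0) (x n) \<le> d * 1" unfolding d_def by (rule dist_le_card)
    then have R: "0 < R" "R \<le> 1" using D d by (auto simp: R_def)
    obtain E where E: "x 0 \<in> E" "\<And>y j. y \<in> E \<Longrightarrow> \<bar>y $ j - x 0 $ j\<bar> \<le> R"
      "\<And>y y'. y \<in> E \<Longrightarrow> y' \<in> K - E \<Longrightarrow> \<exists>j. c * R \<le> \<bar>y $ j - y' $ j\<bar>"
      using c xK[of 0] R unfolding isolated_def by (metis le0 UNIV_I)
    have "x i \<in> E" if "i \<le> n" for i
      using that
    proof (induction i)
      case (Suc i)
      show ?case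
      proof (rule ccontr)
        assume "x (Suc i) \<notin> E"
        then obtain j where "c * R \<le> \<bar>x i $ j - x (Suc i) $ j\<bar>" using E(3)[of "x i" "x (Suc i)"] Suc xK by auto
        then have "c * R \<le> c / (4 * d) * dist (x 0) (x n)"
          using comp[of "x i" j "x (Suc i)"] steps[of i] Suc.prems by linarith
        also have "\<dots> = c * R / 2" using d by (simp add: R_def)
        finally show False using c0 R(1) by simp
      qed
    qed (rule E(1))
    then have "dist (x n) (x 0) \<le> d * R" using E(2) unfolding d_def by (intro dist_le_card) simp
    also have "\<dots> = dist (x 0) (x n) / 2" using d by (simp add: R_def)
    finally show False using D by (simp add: dist_commute)
  qed
  then show ?thesis unfolding uniformly_disconnected_def using c0 d by (intro exI[of _ "c / (4 * d)"]) auto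
qed

section \<open>Full fibres\<close>

text \<open>The map keeps the point of \<open>K\<close> nearest to its fixed point in
  \<open>K\<close> and moves it closer by a factor \<open>s < 1\<close>, so the minimal distance is
  0.\<close>

lemma fixed_point_in_K:
  assumes k: "k \<in> {1..N}"
  shows "(\<chi> j. b k $ j / (1 - T k $ j)) \<in> K"
proof -
  define z where "z = (\<chi> j. b k $ j / (1 - T k $ j))"
  have Tk: "0 < T k $ j" "T k $ j < 1" for j using T_pos[OF k] T_less_1[OF k] by auto
  have z: "T k $ j * z $ j + b k $ j = z $ j" for j
    using Tk(2)[of j] by (simp add: z_def field_simps)
  obtain x where x: "x \<in> K" "\<And>y. y \<in> K \<Longrightarrow> dist z x \<le> dist z y"
    using distance_attains_inf[OF compact_imp_closed[OF compact_K] K_nonempty] by blast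
  define s where "s = Max (range (($) (T k)))"
  have s: "T k $ j \<le> s" for j unfolding s_def by (intro Max_ge) auto
  have "s \<in> range (($) (T k))" unfolding s_def by (intro Max_in) auto
  then have s1: "s < 1" using Tk by auto
  have s0: "0 \<le> s" using s Tk(1) by (meson less_imp_le order_trans)
  have "norm (z - diag_map (T k) (b k) x) \<le> norm (s *\<^sub>R (z - x))"
  proof (rule norm_le_componentwise_cart)
    fix j
    have "(z - diag_map (T k) (b k) x) $ j = T k $ j * (z $ j - x $ j)"
      using z[of j] by (simp add: diag_map_def algebra_simps)
    then show "norm ((z - diag_map (T k) (b k) x) $ j) \<le> norm ((s *\<^sub>R (z - x)) $ j)"
      using Tk[of j] s[of j] s0 by (auto simp: abs_mult intro!: mult_right_mono)
  qed
  then have "dist z (diag_map (T k) (b k) x) \<le> s * dist z x" using s0 by (simp add: dist_norm)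
  with x(2)[OF K_inv[OF k x(1)]] have "dist z x \<le> s * dist z x" by linarith
  then have "(1 - s) * dist z x \<le> 0" by (simp add: algebra_simps)
  then have "dist z x \<le> 0" using s1 by (simp add: mult_le_0_iff)
  then show ?thesis using x(1) by (simp add: z_def)
qed

text \<open>\<open>H\<close> is the slice of \<open>K\<close> over the fixed point \<open>z\<close>
  of the common projected map. All letters of \<open>J\<close> act alike below \<open>i\<close> and
  fix \<open>z\<close> there, so they preserve \<open>H\<close>.\<close>

lemma full_fibre_graph_ifs:
  assumes k\<^sub>0: "k\<^sub>0 \<in> {1..N}" and full: "full_fibre i k\<^sub>0"
  shows "\<exists>J H t\<^sub>0 t\<^sub>1 q. graph_ifs T b J H i t\<^sub>0 t\<^sub>1 q \<and> H \<subseteq> K"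
proof -
  define J where "J = {k\<in>{1..N}. eqv {..<i} k\<^sub>0 k}"
  have J: "k \<in> {1..N}" "j < i \<Longrightarrow> T k $ j = T k\<^sub>0 $ j" "j < i \<Longrightarrow> b k $ j = b k\<^sub>0 $ j" if "k \<in> J" for k j
    using that by (auto simp: J_def eqv_def)
  have finJ: "finite J" by (simp add: J_def)
  have k\<^sub>0J: "k\<^sub>0 \<in> J" using k\<^sub>0 by (simp add: J_def eqv_def)
  define z where "z = (\<chi> j. b k\<^sub>0 $ j / (1 - T k\<^sub>0 $ j))"
  have z: "T k\<^sub>0 $ j * z $ j + b k\<^sub>0 $ j = z $ j" for j
    using T_less_1[OF k\<^sub>0, of j] by (simp add: z_def field_simps)
  define H where "H = {x\<in>K. \<forall>j<i. x $ j = z $ j}"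
  have zH: "z \<in> H" using fixed_point_in_K[OF k\<^sub>0] by (simp add: H_def z_def)
  have H_inv: "diag_map (T k) (b k) x \<in> H" if "k \<in> J" "x \<in> H" for k x
    using that J[OF that(1)] K_inv z unfolding H_def by (auto simp: diag_map_def)
  have compH: "compact H"
  proof -
    have "H = K \<inter> (\<Inter>j\<in>{..<i}. {x. x $ j = z $ j})" by (auto simp: H_def)
    moreover have "closed {x. x $ j = z $ j}" for j by (intro closed_Collect_eq continuous_intros)
    ultimately show ?thesis using compact_K by (auto intro!: compact_Int_closed closed_INT)
  qed
  define t\<^sub>1 where "t\<^sub>1 = Max ((\<lambda>k. T k $ i) ` J)"
  have t1: "T k $ i \<le> t\<^sub>1" if "k \<in> J" for k using that finJ unfolding t\<^sub>1_def by (intro Max_ge) auto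
  have "t\<^sub>1 \<in> (\<lambda>k. T k $ i) ` J" unfolding t\<^sub>1_def using finJ k\<^sub>0J by (intro Max_in) auto
  then have t1': "0 < t\<^sub>1" "t\<^sub>1 < 1" using T_less_1 T_pos J(1) by auto
  \<comment> \<open>The element \<open>1 / 2\<close> keeps \<open>Q\<close> nonempty when
    \<open>i\<close> is the greatest coordinate, and makes \<open>q\<close> positive.\<close>
  define Q where "Q = insert (1 / 2) ((\<lambda>(k, j). T k $ j / T k $ i) ` (J \<times> {i<..}))"
  define q where "q = Max Q"
  have finQ: "finite Q" "Q \<noteq> {}" using finJ by (auto simp: Q_def)
  have q_ge: "x \<le> q" if "x \<in> Q" for x unfolding q_def by (rule Max_ge[OF finQ(1) that])
  have "x < 1" if "x \<in> Q" for x
    using that T_order J(1) T_pos by (auto simp: Q_def)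
  then have q: "0 < q" "q < 1" using Max_in[OF finQ] q_ge[of "1 / 2"] by (auto simp: q_def Q_def)
  have Tq: "T k $ j \<le> q * T k $ i" if "k \<in> J" "i < j" for k j
  proof -
    have "T k $ j / T k $ i \<le> q" using that by (intro q_ge) (force simp: Q_def)
    then show ?thesis using T_pos[OF J(1)[OF that(1)], of i] by (simp add: field_simps)
  qed
  have cover: "\<exists>k\<in>J. b k $ i \<le> u \<and> u \<le> b k $ i + T k $ i" if "0 \<le> u" "u \<le> 1" for u
    using full that unfolding full_fibre_def J_def by blast
  \<comment> \<open>Following the covering intervals for \<open>n\<close> letters reaches the height
    \<open>u\<close> up to \<open>t\<^sub>1 ^ n\<close>; compactness of \<open>H\<close> then gives
    \<open>u\<close> exactly.\<close>
  have approx: "\<exists>h\<in>H. \<bar>u - h $ i\<bar> \<le> t\<^sub>1 ^ n" if "0 \<le> u" "u \<le> 1" for u n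
    using that
  proof (induction n arbitrary: u)
    case 0
    then show ?case using zH K_cube[of z i] by (intro bexI[of _ z]) (auto simp: H_def abs_le_iff)
  next
    case (Suc n)
    obtain k where k: "k \<in> J" "b k $ i \<le> u" "u \<le> b k $ i + T k $ i" using cover[OF Suc.prems] by blast
    note Tk = T_pos[OF J(1)[OF k(1)], of i]
    define u' where "u' = (u - b k $ i) / T k $ i"
    have "0 \<le> u'" "u' \<le> 1" using k Tk by (auto simp: u'_def)
    then obtain h where h: "h \<in> H" "\<bar>u' - h $ i\<bar> \<le> t\<^sub>1 ^ n" using Suc.IH by blast
    have "u - diag_map (T k) (b k) h $ i = T k $ i * (u' - h $ i)"
      using Tk by (simp add: u'_def diag_map_def field_simps)
    then have "\<bar>u - diag_map (T k) (b k) h $ i\<bar> = T k $ i * \<bar>u' - h $ i\<bar>" using Tk by (simp add: abs_mult)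
    also have "\<dots> \<le> t\<^sub>1 * t\<^sub>1 ^ n" using t1[OF k(1)] h(2) t1' Tk by (intro mult_mono) auto
    finally show ?case using H_inv[OF k(1) h(1)] by (intro bexI) auto
  qed
  have onto: "\<exists>h\<in>H. h $ i = u" if u: "0 \<le> u" "u \<le> 1" for u
  proof -
    have "compact ((\<lambda>x. x $ i) ` H)" by (intro compact_continuous_image continuous_intros compH)
    then have cl: "closed ((\<lambda>x. x $ i) ` H)" by (rule compact_imp_closed)
    have "\<exists>y\<in>(\<lambda>x. x $ i) ` H. dist y u < e" if e: "0 < e" for e
    proof -
      obtain n where "t\<^sub>1 ^ n < e" using real_arch_pow_inv[OF e t1'(2)] by blast
      then show ?thesis using approx[OF u, of n] by (force simp: dist_real_def)
    qed
    then have "u \<in> (\<lambda>x. x $ i) ` H" using closed_approachable[OF cl] by blast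
    then show ?thesis by auto
  qed
  have "graph_ifs T b J H i (t_min i) t\<^sub>1 q"
  proof
    show "0 < t_min i" by (rule t_min(1))
    show "t_min i \<le> T k $ i \<and> T k $ i \<le> t\<^sub>1" if "k \<in> J" for k using that t_min(2) J(1) t1 by blast
    show "diag_map (T k) (b k) ` H \<subseteq> H" if "k \<in> J" for k using H_inv that by blast
    show "0 \<le> x $ j \<and> x $ j \<le> 1" if "x \<in> H" for x j using that K_cube by (simp add: H_def)
    show "x $ j = y $ j" if "x \<in> H" "y \<in> H" "j < i" for x y j using that by (simp add: H_def)
  qed (use t1' q T_pos J Tq compH onto cover in auto)
  moreover have "H \<subseteq> K" by (auto simp: H_def)
  ultimately show ?thesis by blast
qed

text \<open>After pulling \<open>d\<close> back to \<open>K\<close>, a full fibre makes the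
  \<open>s\<close>-dimensional measure nonzero for every \<open>s < 1\<close>.\<close>

lemma hausdorff_dim_ge_1:
  assumes k: "k \<in> {1..N}" "full_fibre i k"
    and Y: "Metric_space Y d" and f: "quasisymmetric K dist Y d f"
  shows "1 \<le> hausdorff_dim (f ` K) d"
proof -
  interpret Y: Metric_space Y d by (rule Y)
  obtain \<eta> \<eta>' where \<eta>: "homeomorphism {0..} {0..} \<eta> \<eta>'" and qs: "quasisymmetric_wrt \<eta> K dist Y d f"
    using f by (auto simp: quasisymmetric_def)
  have inj: "inj_on f K" and fY: "\<And>x. x \<in> K \<Longrightarrow> f x \<in> Y" using qs by (auto simp: quasisymmetric_wrt_def)
  define \<rho> where "\<rho> x y = d (f x) (f y)" for x y
  have M: "Metric_space K \<rho>"
    by unfold_locales (use fY inj in \<open>auto simp: \<rho>_def Y.commute inj_on_eq_iff intro: Y.triangle\<close>)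
  obtain J H t\<^sub>0 t\<^sub>1 q where g: "graph_ifs T b J H i t\<^sub>0 t\<^sub>1 q" and HK: "H \<subseteq> K"
    using full_fibre_graph_ifs[OF k] by blast
  have "qs_graph_ifs T b J H i t\<^sub>0 t\<^sub>1 q K \<rho> \<eta>"
  proof (intro qs_graph_ifs.intro g qs_graph_ifs_axioms.intro HK M)
    fix x y z t assume *: "x \<in> K" "y \<in> K" "z \<in> K" "x \<noteq> y" "y \<noteq> z" "x \<noteq> z" "0 < t" "dist x y \<le> t * dist y z"
    then have "dist x y / dist y z \<le> t" by (simp add: field_simps)
    then have "\<rho> x y / \<rho> y z \<le> \<eta> t" using qs * unfolding quasisymmetric_wrt_def \<rho>_def by blast
    moreover have "0 < \<rho> y z" using M * by (simp add: Metric_space.mdist_pos_eq)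
    ultimately show "\<rho> x y \<le> \<eta> t * \<rho> y z" by (simp add: field_simps)
  qed (use homeomorphism_atLeast_0[OF \<eta>] in auto)
  then have pos: "hausdorff_measure K \<rho> s \<noteq> 0" if "0 < s" "s < 1" for s
    using that by (rule qs_graph_ifs.hausdorff_measure_neq_0)
  have "1 \<le> hausdorff_dim K \<rho>"
    unfolding hausdorff_dim_def
  proof (rule INF_greatest)
    fix s assume "s \<in> {s. 0 < s \<and> hausdorff_measure K \<rho> s = 0}"
    then have "1 \<le> s" using pos[of s] by force
    then show "1 \<le> ennreal s" by simp
  qed
  also have "\<dots> \<le> hausdorff_dim (f ` K) d"
    using inj by (rule hausdorff_dim_pullback_le) (simp add: \<rho>_def)
  finally show ?thesis .
qed

end

theorem theorem1p1:
  fixes N :: nat and T b :: "nat \<Rightarrow> real ^ 'n::{finite,linorder}" and K :: "(real ^ 'n::{finite,linorder}) set"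
  assumes "lalley_gatzouras_sponge N T b K"
  shows "conformal_dim K dist = 0 \<longleftrightarrow> uniformly_disconnected K dist"
proof
  interpret sponge N T b K by (rule sponge.intro) (rule assms)
  {
    assume ud: "uniformly_disconnected K dist"
    show "conformal_dim K dist = 0"
      by (rule conformal_dim_eq_0_if_uniformly_disconnected[OF _ ud]) (use K_cube in auto)
  next
    assume cd: "conformal_dim K dist = 0"
    show "uniformly_disconnected K dist"
    proof (rule uniformly_disconnected_if_not_full, rule notI)
      fix i k assume k: "k \<in> {1..N}" "full_fibre i k"
      \<comment> \<open>A full fibre bounds every competitor of the infimum from below by 1.\<close>
      have "1 \<le> conformal_dim K dist"
        unfolding conformal_dim_def by (rule Inf_greatest) (auto intro: hausdorff_dim_ge_1[OF k])
      then show False using cd by simp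
    qed
  }
qed

end
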